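(* Let $\mathcal G$ be a metric graph with metric completion $\overline{\mathcal G}$. Then $\overline{\mathcal G}$ is homeomorphic to the end compactification of $\mathcal G$ if and only if $\overline{\mathcal G}$ is compact and weakly connected.
   Context: A metric graph $\mathcal G$ is a connected, locally finite (every vertex has finite degree) graph with countable vertex set and edge set, in which each edge $e$ is assigned a length $l_e$ with $0<l_e<\infty$ and is identified with a real interval $[a_e,b_e]$ of length $l_e$. Lengths of edges and of their subsets extend to lengths of paths by addition, and the distance $d(x_1,x_2)$ between points $x_1,x_2\in\mathcal G$ is the infimum of the lengths of paths joining them. $\overline{\mathcal G}$ denotes the completion of the metric space $(\mathcal G,d)$. $\overline{\mathcal G}$ is weakly connected if for every pair of distinct points $x,y\in\overline{\mathcal G}$ there is a finite set $W=\{w_1,\dots,w_K\}$ of points of $\mathcal G$ (not necessarily vertices) and disjoint open sets $U,V\subset\overline{\mathcal G}$ with $x\in U$, $y\in V$ and $\overline{\mathcal G}\setminus W=U\cup V$. The end compactification (Freudenthal compactification) of $\mathcal G$ is the usual one for the underlying connected locally finite graph viewed as a 1-complex: its points are the points of $\mathcal G$ together with the ends of $\mathcal G$, where an end is an equivalence class of rays (one-way infinite simple paths), two rays being equivalent if for every finite set $S$ of vertices they have tails in the same component of $\mathcal G\setminus S$. Points of $\mathcal G$ have their usual neighborhoods as points of the 1-complex; a basic neighborhood of an end $\omega$ is given, for a finite vertex set $S$, by the component $C$ of $\mathcal G\setminus S$ containing a tail of every ray of $\omega$, together with all ends having rays in $C$. *)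

theory Defs
  imports "HOL-Analysis.Analysis"
begin

(* Loops and parallel edges are allowed. The orientation of an edge only records which of
   its two vertices corresponds to which endpoint of the interval {left G e..right G e}. *)
record ('v, 'e) mgraph =
  verts :: "'v set"
  edges :: "'e set"
  src :: "'e \<Rightarrow> 'v"
  tgt :: "'e \<Rightarrow> 'v"
  left :: "'e \<Rightarrow> real"
  right :: "'e \<Rightarrow> real"

definition adjacent :: "('v, 'e) mgraph \<Rightarrow> 'v \<Rightarrow> 'v \<Rightarrow> bool" where
  "adjacent G u v \<longleftrightarrow> (\<exists>e\<in>edges G. {src G e, tgt G e} = {u, v})"

locale metric_graph =
  fixes G :: "('v, 'e) mgraph" (structure)
  assumes verts_nonempty: "verts G \<noteq> {}"
    and countable_verts: "countable (verts G)"
    and countable_edges: "countable (edges G)"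
    and src_in_verts: "e \<in> edges G \<Longrightarrow> src G e \<in> verts G"
    and tgt_in_verts: "e \<in> edges G \<Longrightarrow> tgt G e \<in> verts G"
    and left_less_right: "e \<in> edges G \<Longrightarrow> left G e < right G e"
    and locally_finite: "v \<in> verts G \<Longrightarrow> finite {e \<in> edges G. src G e = v \<or> tgt G e = v}"
    and connected_graph: "\<lbrakk>u \<in> verts G; v \<in> verts G\<rbrakk> \<Longrightarrow> (adjacent G)\<^sup>*\<^sup>* u v"

section \<open>The points of the graph and their distance\<close>

datatype ('v, 'e) gpoint = Vertex 'v | Inner 'e real

definition points :: "('v, 'e) mgraph \<Rightarrow> ('v, 'e) gpoint set" where
  "points G = Vertex ` verts G \<union> {Inner e t |e t. e \<in> edges G \<and> left G e < t \<and> t < right G e}"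

(* The identification of the interval of e with the edge e. *)
definition edge_point :: "('v, 'e) mgraph \<Rightarrow> 'e \<Rightarrow> real \<Rightarrow> ('v, 'e) gpoint" where
  "edge_point G e t =
    (if t = left G e then Vertex (src G e) else if t = right G e then Vertex (tgt G e) else Inner e t)"

(* A path is a list of segments (e, s, t), each running along e from parameter s to parameter t. *)
fun is_path ::
  "('v, 'e) mgraph \<Rightarrow> ('v, 'e) gpoint \<Rightarrow> ('e \<times> real \<times> real) list \<Rightarrow> ('v, 'e) gpoint \<Rightarrow> bool" where
  "is_path G x [] y \<longleftrightarrow> x = y \<and> x \<in> points G"
| "is_path G x ((e, s, t) # p) y \<longleftrightarrow>
     e \<in> edges G \<and> s \<in> {left G e..right G e} \<and> t \<in> {left G e..right G e} \<and>
     x = edge_point G e s \<and> is_path G (edge_point G e t) p y"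

definition path_length :: "('e \<times> real \<times> real) list \<Rightarrow> real" where
  "path_length p = (\<Sum>(e, s, t)\<leftarrow>p. \<bar>t - s\<bar>)"

(* The value 0 outside of points G only serves the library's Metric_space, which requires the
   distance function to be nonnegative everywhere. *)
definition gdist :: "('v, 'e) mgraph \<Rightarrow> ('v, 'e) gpoint \<Rightarrow> ('v, 'e) gpoint \<Rightarrow> real" where
  "gdist G x y =
    (if x \<in> points G \<and> y \<in> points G then Inf {path_length p |p. is_path G x p y} else 0)"

definition graph_metric :: "('v, 'e) mgraph \<Rightarrow> ('v, 'e) gpoint metric" where
  "graph_metric G = metric (points G, gdist G)"

context metric_graph
begin

lemma edge_point_in: "\<lbrakk>e \<in> edges G; t \<in> {left G e..right G e}\<rbrakk> \<Longrightarrow> edge_point G e t \<in> points G"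
  by (auto simp: edge_point_def points_def src_in_verts tgt_in_verts)

lemma is_path_points: "is_path G x p y \<Longrightarrow> x \<in> points G \<and> y \<in> points G"
  by (induction p arbitrary: x) (auto simp: edge_point_in)

lemma is_path_append: "\<lbrakk>is_path G x p y; is_path G y q z\<rbrakk> \<Longrightarrow> is_path G x (p @ q) z"
  by (induction p arbitrary: x) auto

lemma path_length_append: "path_length (p @ q) = path_length p + path_length q"
  by (simp add: path_length_def)

lemma path_length_nonneg: "0 \<le> path_length p"
  unfolding path_length_def by (rule sum_list_nonneg) auto

lemma is_path_rev:
  "is_path G x p y \<Longrightarrow> \<exists>q. is_path G y q x \<and> path_length q = path_length p"
proof (induction p arbitrary: x)
  case Nil
  then show ?case by (intro exI[of _ "[]"]) auto
next
  case (Cons a p)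
  obtain e s t where a: "a = (e, s, t)" by (cases a) auto
  with Cons obtain q where q: "is_path G y q (edge_point G e t)" "path_length q = path_length p"
    by auto
  have "is_path G (edge_point G e t) [(e, t, s)] x"
    using Cons.prems a by (auto simp: edge_point_in)
  with q show ?case
    by (intro exI[of _ "q @ [(e, t, s)]"])
      (auto simp: a path_length_append is_path_append, auto simp: path_length_def)
qed

lemma path_to_vertex: assumes "x \<in> points G" shows "\<exists>p v. v \<in> verts G \<and> is_path G x p (Vertex v)"
proof (cases x)
  case (Vertex v)
  with assms show ?thesis by (intro exI[of _ "[]"] exI[of _ v]) (auto simp: points_def)
next
  case (Inner e t)
  with assms have e: "e \<in> edges G" "left G e < t" "t < right G e" by (auto simp: points_def)
  then have "is_path G x [(e, t, left G e)] (Vertex (src G e))"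
    by (auto simp: Inner edge_point_def points_def src_in_verts)
  with e show ?thesis using src_in_verts by blast
qed

lemma path_between_verts:
  assumes "u \<in> verts G" "v \<in> verts G" shows "\<exists>p. is_path G (Vertex u) p (Vertex v)"
  using connected_graph[OF assms]
proof (induction rule: rtranclp_induct)
  case base
  show ?case using assms by (intro exI[of _ "[]"]) (auto simp: points_def)
next
  case (step y z)
  then obtain p e where p: "is_path G (Vertex u) p (Vertex y)"
    and e: "e \<in> edges G" "{src G e, tgt G e} = {y, z}" by (auto simp: adjacent_def)
  have lr: "left G e < right G e" using e left_less_right by auto
  have "\<exists>q. is_path G (Vertex y) q (Vertex z)"
  proof (cases "src G e = y \<and> tgt G e = z")
    case True
    with e lr show ?thesis
      by (intro exI[of _ "[(e, left G e, right G e)]"])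
        (auto simp: edge_point_def points_def tgt_in_verts)
  next
    case False
    then have "src G e = z \<and> tgt G e = y" using e by (auto simp: doubleton_eq_iff)
    with e lr show ?thesis
      by (intro exI[of _ "[(e, right G e, left G e)]"])
        (auto simp: edge_point_def points_def src_in_verts)
  qed
  with p show ?case using is_path_append by blast
qed

lemma path_exists:
  assumes "x \<in> points G" "y \<in> points G" shows "\<exists>p. is_path G x p y"
proof -
  obtain p u where p: "u \<in> verts G" "is_path G x p (Vertex u)" using path_to_vertex[OF assms(1)] by auto
  obtain q v where q: "v \<in> verts G" "is_path G y q (Vertex v)" using path_to_vertex[OF assms(2)] by auto
  obtain r where "is_path G (Vertex u) r (Vertex v)" using path_between_verts p q by blast
  moreover obtain q' where "is_path G (Vertex v) q' y" using is_path_rev[OF q(2)] by auto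
  ultimately show ?thesis using is_path_append p(2) by blast
qed

lemma gdist_le: "is_path G x p y \<Longrightarrow> gdist G x y \<le> path_length p"
  using is_path_points[of x p y]
  unfolding gdist_def by (auto intro!: cInf_lower bdd_belowI[of _ 0] path_length_nonneg)

lemma gdist_ge:
  assumes "x \<in> points G" "y \<in> points G" "\<And>p. is_path G x p y \<Longrightarrow> c \<le> path_length p"
  shows "c \<le> gdist G x y"
proof -
  have "c \<le> Inf {path_length p |p. is_path G x p y}"
    using path_exists[OF assms(1,2)] assms(3) by (intro cInf_greatest) auto
  then show ?thesis using assms(1,2) by (simp add: gdist_def)
qed

lemma gdist_approx:
  assumes "x \<in> points G" "y \<in> points G" "0 < \<epsilon>"
  shows "\<exists>p. is_path G x p y \<and> path_length p < gdist G x y + \<epsilon>"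
proof (rule ccontr)
  assume "\<not> ?thesis"
  then have "gdist G x y + \<epsilon> \<le> gdist G x y" by (intro gdist_ge) (use assms in \<open>auto simp: not_less\<close>)
  with assms show False by simp
qed

lemma gdist_ge_lipschitz:
  assumes f: "\<And>e s t. \<lbrakk>e \<in> edges G; s \<in> {left G e..right G e}; t \<in> {left G e..right G e}\<rbrakk>
      \<Longrightarrow> \<bar>f (edge_point G e t) - f (edge_point G e s)\<bar> \<le> \<bar>t - s\<bar>"
    and xy: "x \<in> points G" "y \<in> points G"
  shows "\<bar>f y - f x\<bar> \<le> gdist G x y"
proof (rule gdist_ge[OF xy])
  fix p assume "is_path G x p y"
  then show "\<bar>f y - f x\<bar> \<le> path_length p"
  proof (induction p arbitrary: x)
    case Nil
    then show ?case by (simp add: path_length_def)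
  next
    case (Cons a p)
    obtain e s t where a: "a = (e, s, t)" by (cases a) auto
    have "\<bar>f y - f (edge_point G e t)\<bar> \<le> path_length p" using Cons a by auto
    moreover have "\<bar>f (edge_point G e t) - f x\<bar> \<le> \<bar>t - s\<bar>" using f Cons.prems a by auto
    ultimately show ?case by (auto simp: a path_length_def)
  qed
qed

lemma gdist_pos_inner:
  assumes x: "Inner e0 t0 \<in> points G" and y: "y \<in> points G" "y \<noteq> Inner e0 t0"
  shows "0 < gdist G (Inner e0 t0) y"
proof -
  define \<epsilon> where "\<epsilon> = min (t0 - left G e0) (right G e0 - t0)"
  have e: "e0 \<in> edges G" "left G e0 < t0" "t0 < right G e0" using x by (auto simp: points_def)
  then have \<epsilon>: "0 < \<epsilon>" by (auto simp: \<epsilon>_def)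
  define f :: "('v, 'e) gpoint \<Rightarrow> real" where
    "f z = (case z of Vertex v \<Rightarrow> 0 | Inner e t \<Rightarrow> if e = e0 then max 0 (\<epsilon> - \<bar>t - t0\<bar>) else 0)" for z
  have fe: "f (edge_point G e t) = (if e = e0 then max 0 (\<epsilon> - \<bar>t - t0\<bar>) else 0)" for e t
    using e by (auto simp: f_def edge_point_def \<epsilon>_def)
  have "\<bar>f y - f (Inner e0 t0)\<bar> \<le> gdist G (Inner e0 t0) y"
    by (rule gdist_ge_lipschitz) (use x y in \<open>auto simp: fe\<close>)
  moreover have "f (Inner e0 t0) = \<epsilon>" using \<epsilon> by (simp add: f_def)
  moreover have "f y < \<epsilon>" using y \<epsilon> by (auto simp: f_def split: gpoint.splits)
  ultimately show ?thesis by linarith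
qed

lemma gdist_pos_vertex:
  assumes u: "u \<in> verts G" and v: "v \<in> verts G" "u \<noteq> v"
  shows "0 < gdist G (Vertex u) (Vertex v)"
proof -
  define D where "D = insert 1 ((\<lambda>e. right G e - left G e) ` {e \<in> edges G. src G e = u \<or> tgt G e = u})"
  define \<epsilon> where "\<epsilon> = Min D"
  have D: "finite D" "D \<noteq> {}" using locally_finite[OF u] by (auto simp: D_def)
  have \<epsilon>: "0 < \<epsilon>" unfolding \<epsilon>_def using D by (subst Min_gr_iff) (auto simp: D_def left_less_right)
  have \<epsilon>_le: "\<epsilon> \<le> right G e - left G e" if "e \<in> edges G" "src G e = u \<or> tgt G e = u" for e
    unfolding \<epsilon>_def using D that by (intro Min_le) (auto simp: D_def)
  define g where "g e t = max 0 (max (if src G e = u then \<epsilon> - (t - left G e) else 0)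
    (if tgt G e = u then \<epsilon> - (right G e - t) else 0))" for e t
  define f :: "('v, 'e) gpoint \<Rightarrow> real" where
    "f z = (case z of Vertex w \<Rightarrow> if w = u then \<epsilon> else 0 | Inner e t \<Rightarrow> g e t)" for z
  have fe: "f (edge_point G e t) = g e t" if "e \<in> edges G" "t \<in> {left G e..right G e}" for e t
  proof -
    consider "t = left G e" | "t = right G e" "t \<noteq> left G e" | "t \<noteq> left G e" "t \<noteq> right G e"
      by blast
    then show ?thesis
    proof cases
      case 1
      then show ?thesis
        using \<epsilon>_le[of e] that left_less_right[of e] \<epsilon> by (simp add: f_def edge_point_def g_def)
    next
      case 2
      then show ?thesis
        using \<epsilon>_le[of e] that left_less_right[of e] \<epsilon> by (simp add: f_def edge_point_def g_def)
    next
      case 3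
      then show ?thesis by (simp add: f_def edge_point_def)
    qed
  qed
  have max_lipschitz: "\<bar>max a b - max c d\<bar> \<le> k" if "\<bar>a - c\<bar> \<le> k" "\<bar>b - d\<bar> \<le> k"
    for a b c d k :: real
    using that by linarith
  have g: "\<bar>g e t - g e s\<bar> \<le> \<bar>t - s\<bar>" for e s t
    unfolding g_def by (intro max_lipschitz) (simp_all add: abs_minus_commute)
  have "\<bar>f (Vertex v) - f (Vertex u)\<bar> \<le> gdist G (Vertex u) (Vertex v)"
    by (rule gdist_ge_lipschitz) (use u v g in \<open>simp_all add: fe points_def\<close>)
  then show ?thesis using \<epsilon> v by (simp add: f_def split: if_splits)
qed

lemma gdist_nonneg: "\<lbrakk>x \<in> points G; y \<in> points G\<rbrakk> \<Longrightarrow> 0 \<le> gdist G x y"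
  by (intro gdist_ge path_length_nonneg)

lemma gdist_self: "x \<in> points G \<Longrightarrow> gdist G x x = 0"
  using gdist_le[of x "[]" x] gdist_nonneg[of x x] by (auto simp: path_length_def)

lemma gdist_commute: "gdist G x y = gdist G y x"
proof -
  have "{path_length p |p. is_path G x p y} = {path_length p |p. is_path G y p x}"
    by (metis (no_types, lifting) is_path_rev)
  then show ?thesis unfolding gdist_def by (cases "x \<in> points G"; cases "y \<in> points G") simp_all
qed

lemma gdist_triangle:
  assumes "x \<in> points G" "y \<in> points G" "z \<in> points G"
  shows "gdist G x z \<le> gdist G x y + gdist G y z"
proof (rule field_le_epsilon)
  fix \<epsilon> :: real assume \<epsilon>: "0 < \<epsilon>"
  obtain p where p: "is_path G x p y" "path_length p < gdist G x y + \<epsilon> / 2"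
    using gdist_approx[of x y "\<epsilon> / 2"] assms \<epsilon> by auto
  obtain q where q: "is_path G y q z" "path_length q < gdist G y z + \<epsilon> / 2"
    using gdist_approx[of y z "\<epsilon> / 2"] assms \<epsilon> by auto
  show "gdist G x z \<le> gdist G x y + gdist G y z + \<epsilon>"
    using gdist_le[OF is_path_append[OF p(1) q(1)]] p q by (simp add: path_length_append)
qed

lemma gdist_pos:
  assumes x: "x \<in> points G" and y: "y \<in> points G" "x \<noteq> y"
  shows "0 < gdist G x y"
proof (cases x)
  case (Inner e t)
  with assms show ?thesis using gdist_pos_inner[of e t y] by auto
next
  case (Vertex u)
  show ?thesis
  proof (cases y)
    case (Inner e t)
    with assms show ?thesis using gdist_pos_inner[of e t x] gdist_commute[of x y] by auto
  next
    case (Vertex v)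
    with assms \<open>x = Vertex u\<close> show ?thesis using gdist_pos_vertex[of u v] by (auto simp: points_def)
  qed
qed

lemma Metric_space_gdist: "Metric_space (points G) (gdist G)"
proof
  show "0 \<le> gdist G x y" for x y
    by (cases "x \<in> points G \<and> y \<in> points G") (auto simp: gdist_nonneg, auto simp: gdist_def)
  show "gdist G x y = gdist G y x" for x y by (rule gdist_commute)
  show "gdist G x y = 0 \<longleftrightarrow> x = y" if "x \<in> points G" "y \<in> points G" for x y
    using gdist_pos[OF that] gdist_self[OF that(1)] by (cases "x = y") auto
qed (rule gdist_triangle)

lemma mspace_graph_metric: "mspace (graph_metric G) = points G"
  and mdist_graph_metric: "mdist (graph_metric G) = gdist G"
  by (simp_all add: graph_metric_def Metric_space.mspace_metric Metric_space.mdist_metric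
      Metric_space_gdist)

end

(* m together with the embedding f is a completion of m0; it is determined up to isometry. *)
definition is_completion :: "'a metric \<Rightarrow> ('a \<Rightarrow> 'b) \<Rightarrow> 'b metric \<Rightarrow> bool" where
  "is_completion m0 f m \<longleftrightarrow>
     mcomplete_of m \<and> f \<in> mspace m0 \<rightarrow> mspace m \<and>
     (\<forall>x\<in>mspace m0. \<forall>y\<in>mspace m0. mdist m (f x) (f y) = mdist m0 x y) \<and>
     mtopology_of m closure_of (f ` mspace m0) = mspace m"

lemma completion_exists:
  fixes m0 :: "'a metric"
  obtains f :: "'a \<Rightarrow> 'a \<Rightarrow> real" and m where "is_completion m0 f m"
proof -
  interpret Metric_space "mspace m0" "mdist m0" by simp
  show thesis
  proof (rule metric_completion)
    fix f :: "'a \<Rightarrow> 'a \<Rightarrow> real" and m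
    assume "mcomplete_of m" "f \<in> mspace m0 \<rightarrow> mspace m"
      "mtopology_of m closure_of f ` mspace m0 = mspace m"
      "\<And>x y. \<lbrakk>x \<in> mspace m0; y \<in> mspace m0\<rbrakk> \<Longrightarrow> mdist m (f x) (f y) = mdist m0 x y"
    then have "is_completion m0 f m" by (simp add: is_completion_def)
    then show thesis by (rule that)
  qed
qed

(* X is separated by finite subsets of A; below, A is the image of the graph in its completion. *)
definition weakly_connected :: "'a topology \<Rightarrow> 'a set \<Rightarrow> bool" where
  "weakly_connected X A \<longleftrightarrow>
     (\<forall>x\<in>topspace X. \<forall>y\<in>topspace X. x \<noteq> y \<longrightarrow>
       (\<exists>W U V. finite W \<and> W \<subseteq> A \<and> openin X U \<and> openin X V \<and> disjnt U V \<and>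
         x \<in> U \<and> y \<in> V \<and> topspace X - W = U \<union> V))"

section \<open>The end compactification\<close>

(* The graph as a 1-complex: the quotient topology of the disjoint union of its vertices and the
   edge intervals. *)
definition complex_topology :: "('v, 'e) mgraph \<Rightarrow> ('v, 'e) gpoint topology" where
  "complex_topology G = topology (\<lambda>U. U \<subseteq> points G \<and>
     (\<forall>e\<in>edges G. openin (top_of_set {left G e..right G e})
       {t \<in> {left G e..right G e}. edge_point G e t \<in> U}))"

lemma openin_complex_topology:
  "openin (complex_topology G) U \<longleftrightarrow> U \<subseteq> points G \<and>
     (\<forall>e\<in>edges G. openin (top_of_set {left G e..right G e})
       {t \<in> {left G e..right G e}. edge_point G e t \<in> U})"
proof -
  have "istopology (\<lambda>U. U \<subseteq> points G \<and>
     (\<forall>e\<in>edges G. openin (top_of_set {left G e..right G e})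
       {t \<in> {left G e..right G e}. edge_point G e t \<in> U}))" (is "istopology ?P")
    unfolding istopology_def
  proof (intro conjI allI impI)
    fix S T assume ST: "?P S" "?P T"
    then show "S \<inter> T \<subseteq> points G" by auto
    show "\<forall>e\<in>edges G. openin (top_of_set {left G e..right G e})
       {t \<in> {left G e..right G e}. edge_point G e t \<in> S \<inter> T}"
    proof
      fix e assume e: "e \<in> edges G"
      have "{t \<in> {left G e..right G e}. edge_point G e t \<in> S \<inter> T} =
        {t \<in> {left G e..right G e}. edge_point G e t \<in> S} \<inter>
        {t \<in> {left G e..right G e}. edge_point G e t \<in> T}" by auto
      then show "openin (top_of_set {left G e..right G e})
        {t \<in> {left G e..right G e}. edge_point G e t \<in> S \<inter> T}"
        using ST e by (auto intro: openin_Int)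
    qed
  next
    fix \<K> assume K: "\<forall>K\<in>\<K>. ?P K"
    then show "\<Union>\<K> \<subseteq> points G" by auto
    show "\<forall>e\<in>edges G. openin (top_of_set {left G e..right G e})
       {t \<in> {left G e..right G e}. edge_point G e t \<in> \<Union>\<K>}"
    proof
      fix e assume e: "e \<in> edges G"
      have "{t \<in> {left G e..right G e}. edge_point G e t \<in> \<Union>\<K>} =
        (\<Union>K\<in>\<K>. {t \<in> {left G e..right G e}. edge_point G e t \<in> K})" by auto
      then show "openin (top_of_set {left G e..right G e})
        {t \<in> {left G e..right G e}. edge_point G e t \<in> \<Union>\<K>}"
        using K e by (auto intro: openin_Union)
    qed
  qed
  then show ?thesis by (simp add: complex_topology_def topology_inverse')
qed

definition components_minus :: "('v, 'e) mgraph \<Rightarrow> 'v set \<Rightarrow> ('v, 'e) gpoint set set" where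
  "components_minus G S =
     connected_components_of (subtopology (complex_topology G) (points G - Vertex ` S))"

(* A ray is given by its sequence of vertices; with parallel edges present this does not single
   out the edges used, which are irrelevant for the end the ray belongs to. *)
definition ray :: "('v, 'e) mgraph \<Rightarrow> (nat \<Rightarrow> 'v) \<Rightarrow> bool" where
  "ray G r \<longleftrightarrow> inj r \<and> range r \<subseteq> verts G \<and> (\<forall>n. adjacent G (r n) (r (Suc n)))"

(* No vertex of S lies in a component of the graph minus S, so an edge between consecutive vertices
   of the tail lies in C as soon as these vertices do. *)
definition has_tail_in :: "(nat \<Rightarrow> 'v) \<Rightarrow> ('v, 'e) gpoint set \<Rightarrow> bool" where
  "has_tail_in r C \<longleftrightarrow> (\<exists>N. \<forall>n\<ge>N. Vertex (r n) \<in> C)"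

definition end_equiv :: "('v, 'e) mgraph \<Rightarrow> ((nat \<Rightarrow> 'v) \<times> (nat \<Rightarrow> 'v)) set" where
  "end_equiv G = {(r, r'). ray G r \<and> ray G r' \<and>
     (\<forall>S. finite S \<and> S \<subseteq> verts G \<longrightarrow>
       (\<exists>C\<in>components_minus G S. has_tail_in r C \<and> has_tail_in r' C))}"

definition ends :: "('v, 'e) mgraph \<Rightarrow> (nat \<Rightarrow> 'v) set set" where
  "ends G = Collect (ray G) // end_equiv G"

definition end_nbhd ::
  "('v, 'e) mgraph \<Rightarrow> ('v, 'e) gpoint set \<Rightarrow> (('v, 'e) gpoint + (nat \<Rightarrow> 'v) set) set" where
  "end_nbhd G C = Inl ` C \<union> Inr ` {\<omega> \<in> ends G. \<exists>r\<in>\<omega>. \<forall>n. Vertex (r n) \<in> C}"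

definition end_compactification ::
  "('v, 'e) mgraph \<Rightarrow> (('v, 'e) gpoint + (nat \<Rightarrow> 'v) set) topology" where
  "end_compactification G = topology_generated_by
     ({Inl ` U |U. openin (complex_topology G) U} \<union>
      {end_nbhd G C |C S. finite S \<and> S \<subseteq> verts G \<and> C \<in> components_minus G S})"

end

theory Submission
  imports Defs
begin

text \<open>Write \<open>E\<close> for the end compactification. Two facts about \<open>E\<close> carry the proof: it is compact
  (Koenig's lemma), and any two of its points are separated by finitely many inner points of edges.
  More generally, a partition of the graph minus a finite set of points into two open sets extends
  to the ends, since a component of the complement of a finite vertex set that contains a vertex
  can be chosen to miss the finite set.

  If the completion is compact and weakly connected, this extension property shows that the graph
  accumulates, at each point of \<open>E\<close>, to exactly one point of the completion. The resulting map from
  \<open>E\<close> to the completion is continuous and onto. It is injective because near a point \<open>q\<close> of the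
  completion two points of the graph are joined by a short path in the graph, which stays near
  \<open>q\<close> and so cannot cross a finite set of points other than \<open>q\<close>.

  Conversely, weak connectedness is transported along a homeomorphism from \<open>E\<close>. The same remark on
  short paths shows that inner points of edges are sent to points of the graph, even if the
  homeomorphism does not respect the two copies of the graph.\<close>

text \<open>A priori an end may accumulate at many points of the completion, or at none, as for a
  ray of infinite length. Points of the two spaces are therefore compared only through open subsets
  of the graph and the closures of their images. This is why a separation is recorded inside the
  graph, as two disjoint open sets of the 1-complex with a finite remainder \<open>W\<close>: the
  same triple can be read in the end compactification and, through \<open>\<iota>\<close>, in the
  completion.

  Weak connectedness demands cut points in the graph, and this dictates cutting at inner points of
  edges. If a ray has finite total length, both spaces are an arc from a vertex to an end, and
  reversing the arc carries that vertex to a point outside the graph. A homeomorphism thus need not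
  keep vertices inside the graph, whereas an inner point of an edge is recognised topologically,
  because it splits its small neighbourhoods.

  The argument with short paths fails when the centre \<open>q\<close> is itself a cut point. Points
  of the graph are treated separately for this reason, by comparing metric balls with neighbourhoods
  in the 1-complex, where local finiteness enters.\<close>

lemma openin_mtopology_of_iff:
  "openin (mtopology_of m) U \<longleftrightarrow>
    U \<subseteq> mspace m \<and> (\<forall>p\<in>U. \<exists>r>0. \<forall>q\<in>mspace m. mdist m p q < r \<longrightarrow> q \<in> U)"
proof -
  interpret Metric_space "mspace m" "mdist m" by simp
  have "mball p r \<subseteq> U \<longleftrightarrow> (\<forall>q\<in>mspace m. mdist m p q < r \<longrightarrow> q \<in> U)" if "p \<in> mspace m" for p r
    using that by auto
  then have ball: "(\<exists>r>0. mball p r \<subseteq> U) \<longleftrightarrow> (\<exists>r>0. \<forall>q\<in>mspace m. mdist m p q < r \<longrightarrow> q \<in> U)"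
    if "p \<in> mspace m" for p
    using that by presburger
  have "(\<forall>p. p \<in> U \<longrightarrow> (\<exists>r>0. mball p r \<subseteq> U)) \<longleftrightarrow>
      (\<forall>p\<in>U. \<exists>r>0. \<forall>q\<in>mspace m. mdist m p q < r \<longrightarrow> q \<in> U)" if "U \<subseteq> mspace m"
    unfolding Ball_def[of U] by (intro all_cong1 imp_cong refl ball subsetD[OF that])
  then show ?thesis
    unfolding mtopology_of_def openin_mtopology by (rule conj_cong[OF refl])
qed

lemma openin_mtopology_of_ball:
  assumes "p \<in> mspace m" shows "openin (mtopology_of m) {q \<in> mspace m. mdist m p q < r}"
proof -
  interpret Metric_space "mspace m" "mdist m" by simp
  have "{q \<in> mspace m. mdist m p q < r} = mball p r" using assms by auto
  then show ?thesis unfolding mtopology_of_def by simp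
qed

lemma Hausdorff_mtopology_of: "Hausdorff_space (mtopology_of m)"
  unfolding mtopology_of_def by (rule Metric_space.Hausdorff_space_mtopology) simp

lemma in_closure_mtopology_ofD:
  assumes "p \<in> mtopology_of m closure_of S" "0 < r"
  obtains q where "q \<in> S" "q \<in> mspace m" "mdist m p q < r"
proof -
  have p: "p \<in> mspace m" using assms(1) by (simp add: in_closure_of)
  let ?B = "{q \<in> mspace m. mdist m p q < r}"
  have "mdist m p p < r" using mdist_zero[OF p p] assms(2) by metis
  then have B: "p \<in> ?B \<and> openin (mtopology_of m) ?B"
    using openin_mtopology_of_ball[OF p] p by simp
  have meets: "\<forall>T. p \<in> T \<and> openin (mtopology_of m) T \<longrightarrow> (\<exists>y. y \<in> S \<and> y \<in> T)"
    using assms(1) unfolding in_closure_of by (rule conjunct2)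
  show thesis using meets[THEN spec, THEN mp, OF B] that by auto
qed

lemma not_in_closure_of:
  assumes "openin X V" "p \<in> V" "S \<inter> V = {}"
  shows "p \<notin> X closure_of S"
proof
  assume "p \<in> X closure_of S"
  then have "\<forall>T. p \<in> T \<and> openin X T \<longrightarrow> (\<exists>y. y \<in> S \<and> y \<in> T)"
    unfolding in_closure_of by (rule conjunct2)
  from this[THEN spec, of V] show False using assms by auto
qed

context metric_graph
begin

subsection \<open>The 1-complex and its components\<close>

lemma edge_point_inner [simp]:
  "\<lbrakk>left G e < t; t < right G e\<rbrakk> \<Longrightarrow> edge_point G e t = Inner e t"
  by (simp add: edge_point_def)

lemma edge_point_left [simp]: "edge_point G e (left G e) = Vertex (src G e)"
  by (simp add: edge_point_def)

lemma edge_point_right [simp]: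
  "e \<in> edges G \<Longrightarrow> edge_point G e (right G e) = Vertex (tgt G e)"
  using left_less_right[of e] by (simp add: edge_point_def)

lemma edge_param_cases:
  assumes "e \<in> edges G" "t \<in> {left G e..right G e}"
  obtains "t = left G e" "edge_point G e t = Vertex (src G e)"
    | "t = right G e" "edge_point G e t = Vertex (tgt G e)"
    | "left G e < t" "t < right G e" "edge_point G e t = Inner e t"
proof (cases "t = left G e")
  case False
  then show thesis
    using assms that(2,3) by (cases "t = right G e") (auto simp: less_le)
qed (simp add: that(1))

lemma points_cases:
  assumes "x \<in> points G"
  obtains v where "v \<in> verts G" "x = Vertex v"
    | e t where "e \<in> edges G" "left G e < t" "t < right G e" "x = Inner e t"
  using assms by (auto simp: points_def)

lemma Vertex_in_points [simp]: "Vertex v \<in> points G \<longleftrightarrow> v \<in> verts G"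
  by (auto simp: points_def)

lemma Inner_in_points [simp]:
  "Inner e t \<in> points G \<longleftrightarrow> e \<in> edges G \<and> left G e < t \<and> t < right G e"
  by (auto simp: points_def)

lemma topspace_complex [simp]: "topspace (complex_topology G) = points G"
proof
  have "openin (complex_topology G) (points G)"
  proof (unfold openin_complex_topology, intro conjI ballI)
    fix e assume "e \<in> edges G"
    then have "{t \<in> {left G e..right G e}. edge_point G e t \<in> points G} = {left G e..right G e}"
      using edge_point_in by auto
    then show "openin (top_of_set {left G e..right G e})
      {t \<in> {left G e..right G e}. edge_point G e t \<in> points G}" by simp
  qed simp
  then show "points G \<subseteq> topspace (complex_topology G)" by (rule openin_subset)
qed (auto simp: topspace_def openin_complex_topology)

lemma continuous_edge_point:
  "e \<in> edges G \<Longrightarrow>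
    continuous_map (top_of_set {left G e..right G e}) (complex_topology G) (edge_point G e)"
  unfolding continuous_map_def using edge_point_in
  by (auto simp: openin_complex_topology Pi_iff)

lemma connectedin_edge_image:
  assumes "e \<in> edges G" "I \<subseteq> {left G e..right G e}" "connected I"
  shows "connectedin (complex_topology G) (edge_point G e ` I)"
  by (rule connectedin_continuous_map_image[OF continuous_edge_point])
    (use assms in \<open>auto simp: connectedin_subtopology\<close>)

text \<open>On each edge interval at most the two endpoints are removed, so the preimage is open
  even if \<open>S\<close> is infinite.\<close>

lemma openin_complex_minus_verts: "openin (complex_topology G) (points G - Vertex ` S)"
proof (unfold openin_complex_topology, intro conjI ballI)
  fix e assume e: "e \<in> edges G"
  let ?I = "{left G e..right G e}" and ?B = "{t \<in> {left G e, right G e}. edge_point G e t \<in> Vertex ` S}"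
  have "edge_point G e t \<in> points G - Vertex ` S \<longleftrightarrow> t \<notin> ?B" if "t \<in> ?I" for t
    using e that by (cases rule: edge_param_cases[OF e that]) (auto simp: src_in_verts tgt_in_verts)
  then have "{t \<in> ?I. edge_point G e t \<in> points G - Vertex ` S} = ?I \<inter> - ?B" by blast
  moreover have "open (- ?B)" by (intro open_Compl finite_imp_closed) auto
  ultimately show "openin (top_of_set ?I) {t \<in> ?I. edge_point G e t \<in> points G - Vertex ` S}"
    by (simp only: openin_open_Int)
qed auto

lemma openin_complex_Inner_image:
  assumes "e \<in> edges G" "open I"
  shows "openin (complex_topology G) (Inner e ` ({left G e<..<right G e} \<inter> I))"
proof (unfold openin_complex_topology, intro conjI ballI)
  fix e' assume e': "e' \<in> edges G"
  let ?J = "{left G e'..right G e'}" and ?U = "Inner e ` ({left G e<..<right G e} \<inter> I)"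
  have "edge_point G e' t \<in> ?U \<longleftrightarrow> t \<in> (if e' = e then {left G e<..<right G e} \<inter> I else {})"
    if "t \<in> ?J" for t
    by (cases rule: edge_param_cases[OF e' that]) auto
  then have "{t \<in> ?J. edge_point G e' t \<in> ?U} = ?J \<inter> (if e' = e then {left G e<..<right G e} \<inter> I else {})"
    by blast
  moreover have "open (if e' = e then {left G e<..<right G e} \<inter> I else {})"
    using assms(2) by (simp add: open_Int)
  ultimately show "openin (top_of_set ?J) {t \<in> ?J. edge_point G e' t \<in> ?U}"
    by (simp only: openin_open_Int)
qed (use assms in auto)

lemma component_subset: "C \<in> components_minus G S \<Longrightarrow> C \<subseteq> points G - Vertex ` S"
  unfolding components_minus_def using connected_components_of_subset by fastforce

lemma component_nonempty: "C \<in> components_minus G S \<Longrightarrow> C \<noteq> {}"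
  unfolding components_minus_def using nonempty_connected_components_of by blast

lemma component_connected: "C \<in> components_minus G S \<Longrightarrow> connectedin (complex_topology G) C"
  unfolding components_minus_def
  using connectedin_connected_components_of connectedin_subtopology by blast

lemma component_maximal:
  "\<lbrakk>C \<in> components_minus G S; connectedin (complex_topology G) A; A \<subseteq> points G - Vertex ` S;
    x \<in> A; x \<in> C\<rbrakk> \<Longrightarrow> A \<subseteq> C"
  unfolding components_minus_def
  using connected_components_of_maximal connectedin_subtopology by (metis disjnt_iff)

lemma component_exists:
  assumes "x \<in> points G" "x \<notin> Vertex ` S"
  obtains C where "C \<in> components_minus G S" "x \<in> C"
proof -
  have "x \<in> \<Union> (components_minus G S)"
    unfolding components_minus_def Union_connected_components_of using assms by auto
  then show thesis using that by blast
qed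

lemma component_mono:
  assumes "C' \<in> components_minus G S'" "C \<in> components_minus G S" "S \<subseteq> S'" "x \<in> C'" "x \<in> C"
  shows "C' \<subseteq> C"
  using assms component_subset[OF assms(1)]
  by (intro component_maximal[OF assms(2) component_connected[OF assms(1)] _ assms(4,5)]) auto

lemma component_unique:
  assumes "C' \<in> components_minus G S" "C \<in> components_minus G S" "x \<in> C'" "x \<in> C"
  shows "C' = C"
  using component_mono[of C' S C S x] component_mono[of C S C' S x] assms by auto

text \<open>Only the two end parameters can give vertices, so what remains is an interval.\<close>

lemma connected_edge_params:
  assumes e: "e \<in> edges G"
  shows "connected {t \<in> {left G e..right G e}. edge_point G e t \<notin> Vertex ` S}"
  unfolding is_interval_connected_1[symmetric] is_interval_1
proof (intro ballI allI impI)
  fix a b t assume ab: "a \<in> {t \<in> {left G e..right G e}. edge_point G e t \<notin> Vertex ` S}"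
    "b \<in> {t \<in> {left G e..right G e}. edge_point G e t \<notin> Vertex ` S}" "a \<le> t \<and> t \<le> b"
  show "t \<in> {t \<in> {left G e..right G e}. edge_point G e t \<notin> Vertex ` S}"
  proof (cases "t = a \<or> t = b")
    case False
    with ab show ?thesis by auto
  qed (use ab in auto)
qed

text \<open>The part of an edge that avoids \<open>S\<close> is connected, hence contained in a
  single component. Most facts about components below reduce to this one.\<close>

lemma component_edge_closed:
  assumes C: "C \<in> components_minus G S" and e: "e \<in> edges G"
    and s: "s \<in> {left G e..right G e}" "edge_point G e s \<in> C"
    and t: "t \<in> {left G e..right G e}" "edge_point G e t \<notin> Vertex ` S"
  shows "edge_point G e t \<in> C"
proof -
  let ?J = "{t \<in> {left G e..right G e}. edge_point G e t \<notin> Vertex ` S}"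
  have "edge_point G e ` ?J \<subseteq> C"
  proof (rule component_maximal[OF C])
    show "connectedin (complex_topology G) (edge_point G e ` ?J)"
      by (rule connectedin_edge_image[OF e _ connected_edge_params[OF e]]) auto
    show "edge_point G e ` ?J \<subseteq> points G - Vertex ` S" using edge_point_in[OF e] by fast
    show "edge_point G e s \<in> edge_point G e ` ?J" using s component_subset[OF C] by blast
  qed (rule s)
  with t show ?thesis by auto
qed

lemma component_adjacent:
  assumes C: "C \<in> components_minus G S" and "adjacent G u v" "Vertex u \<in> C" "v \<notin> S"
  shows "Vertex v \<in> C"
proof -
  obtain e where e: "e \<in> edges G" "{src G e, tgt G e} = {u, v}"
    using assms by (auto simp: adjacent_def)
  then have lr: "left G e < right G e" using left_less_right by auto
  consider "src G e = u" "tgt G e = v" | "src G e = v" "tgt G e = u"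
    using e by (auto simp: doubleton_eq_iff)
  then show ?thesis
  proof cases
    case 1
    then show ?thesis
      using component_edge_closed[OF C e(1), of "left G e" "right G e"] assms lr e by auto
  next
    case 2
    then show ?thesis
      using component_edge_closed[OF C e(1), of "right G e" "left G e"] assms lr e by auto
  qed
qed

text \<open>Components need not be open in a general space. Here the trace of \<open>C\<close> on an
  edge is either empty or everything outside \<open>S\<close>, and both are open in the
  interval.\<close>

lemma openin_component:
  assumes C: "C \<in> components_minus G S"
  shows "openin (complex_topology G) C"
proof (unfold openin_complex_topology, intro conjI ballI)
  show "C \<subseteq> points G" using component_subset[OF C] by auto
next
  fix e assume e: "e \<in> edges G"
  let ?I = "{left G e..right G e}"
  show "openin (top_of_set ?I) {t \<in> ?I. edge_point G e t \<in> C}"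
  proof (cases "\<exists>s\<in>?I. edge_point G e s \<in> C")
    case True
    then obtain s where s: "s \<in> ?I" "edge_point G e s \<in> C" by blast
    have "edge_point G e t \<in> C \<longleftrightarrow> edge_point G e t \<in> points G - Vertex ` S" if "t \<in> ?I" for t
      using component_edge_closed[OF C e s that] component_subset[OF C] edge_point_in[OF e that] by blast
    then have "{t \<in> ?I. edge_point G e t \<in> C} = {t \<in> ?I. edge_point G e t \<in> points G - Vertex ` S}"
      by blast
    then show ?thesis using openin_complex_minus_verts[of S] e by (simp add: openin_complex_topology)
  next
    case False
    then have "{t \<in> ?I. edge_point G e t \<in> C} = {}" by blast
    then show ?thesis by (simp only: openin_empty)
  qed
qed

text \<open>With both endpoints in \<open>S\<close>, the open edge and the rest of the graph minus
  \<open>S\<close> are both open, so the connected set \<open>C\<close> cannot meet both.\<close>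

lemma component_within_edge:
  assumes C: "C \<in> components_minus G S" and e: "Inner e t \<in> C" "src G e \<in> S" "tgt G e \<in> S"
  shows "C \<subseteq> Inner e ` {left G e<..<right G e}"
proof -
  have eG: "Inner e t \<in> points G" using C e component_subset by blast
  let ?I = "Inner e ` {left G e<..<right G e}"
  have 1: "openin (complex_topology G) ?I"
    using openin_complex_Inner_image[of e UNIV] eG by simp
  have 2: "openin (complex_topology G) (points G - Vertex ` S - ?I)"
  proof (unfold openin_complex_topology, intro conjI ballI)
    fix e' assume e': "e' \<in> edges G"
    let ?J = "{left G e'..right G e'}"
    show "openin (top_of_set ?J) {t \<in> ?J. edge_point G e' t \<in> points G - Vertex ` S - ?I}"
    proof (cases "e' = e")
      case True
      have "edge_point G e s \<notin> points G - Vertex ` S - ?I" if "s \<in> {left G e..right G e}" for s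
        by (rule edge_param_cases[OF _ that]) (use eG e in auto)
      then have "{t \<in> ?J. edge_point G e' t \<in> points G - Vertex ` S - ?I} = {}"
        using True by blast
      then show ?thesis by (simp only: openin_empty)
    next
      case False
      then have I: "edge_point G e' s \<notin> ?I" for s by (auto simp: edge_point_def)
      have "{t \<in> ?J. edge_point G e' t \<in> points G - Vertex ` S - ?I}
        = {t \<in> ?J. edge_point G e' t \<in> points G - Vertex ` S}" using I by blast
      then show ?thesis
        using openin_complex_minus_verts[of S] e' by (simp add: openin_complex_topology)
    qed
  qed auto
  have "(points G - Vertex ` S - ?I) \<inter> C = {}"
  proof (rule ccontr)
    assume ne: "(points G - Vertex ` S - ?I) \<inter> C \<noteq> {}"
    have "?I \<inter> (points G - Vertex ` S - ?I) \<inter> C = {}" by blast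
    moreover have "C \<subseteq> ?I \<union> (points G - Vertex ` S - ?I)" using component_subset[OF C] by blast
    moreover have "Inner e t \<in> ?I \<inter> C" using eG e by simp
    then have "?I \<inter> C \<noteq> {}" by (metis empty_iff)
    ultimately show False using connectedinD[OF component_connected[OF C] 1 2 _ _ _ ne] by metis
  qed
  then show ?thesis using component_subset[OF C] by blast
qed

text \<open>An inner point of an edge with an endpoint outside \<open>S\<close> drags that endpoint
  into its component. The vertexless components lie inside one edge, and the compactness proof
  disposes of them by compactness of the closed edge.\<close>

lemma component_vertex_or_edge:
  assumes C: "C \<in> components_minus G S"
  obtains v where "v \<in> verts G" "v \<notin> S" "Vertex v \<in> C"
    | e where "e \<in> edges G" "C \<subseteq> Inner e ` {left G e<..<right G e}"
proof -
  obtain x where x: "x \<in> C" "x \<in> points G" using component_nonempty[OF C] component_subset[OF C] by auto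
  from x(2) show thesis
  proof (cases rule: points_cases)
    case (1 v)
    then show thesis using that(1) x component_subset[OF C] by auto
  next
    case (2 e t)
    have lr: "left G e < right G e" using 2 by auto
    have *: "Vertex v \<in> C" if "v \<in> {src G e, tgt G e}" "v \<notin> S" for v
      using component_edge_closed[OF C, of e t "left G e"] component_edge_closed[OF C, of e t "right G e"]
        x that 2 by auto
    show thesis
    proof (cases "src G e \<in> S \<and> tgt G e \<in> S")
      case True
      then show thesis using that(2) component_within_edge[OF C, of e t] x 2 by auto
    next
      case False
      then show thesis using that(1) *[of "src G e"] *[of "tgt G e"] 2 src_in_verts tgt_in_verts by blast
    qed
  qed
qed

text \<open>Consider the first segment of the path that ends in a vertex of \<open>S\<close>. Its
  edge is incident with \<open>S\<close>, and since the segment starts in \<open>C\<close>, the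
  midpoint of that edge lies in \<open>C\<close>.\<close>

lemma component_path:
  assumes C: "C \<in> components_minus G S"
  shows "is_path G x p y \<Longrightarrow> x \<in> C \<Longrightarrow>
    y \<in> C \<or> (\<exists>e\<in>edges G. (src G e \<in> S \<or> tgt G e \<in> S) \<and> Inner e ((left G e + right G e) / 2) \<in> C)"
proof (induction p arbitrary: x)
  case (Cons a p)
  obtain e s t where a: "a = (e, s, t)" by (cases a) auto
  have e: "e \<in> edges G" and st: "s \<in> {left G e..right G e}" "t \<in> {left G e..right G e}"
    and x: "edge_point G e s \<in> C" and p: "is_path G (edge_point G e t) p y"
    using Cons.prems by (auto simp: a)
  have lr: "left G e < right G e" using e left_less_right by auto
  show ?case
  proof (cases "edge_point G e t \<in> Vertex ` S")
    case True
    then have "src G e \<in> S \<or> tgt G e \<in> S"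
      by (cases rule: edge_param_cases[OF e st(2)]) auto
    moreover have "edge_point G e ((left G e + right G e) / 2) \<in> C"
      by (rule component_edge_closed[OF C e st(1) x]) (use lr in auto)
    ultimately show ?thesis using e lr by auto
  next
    case False
    then show ?thesis
      using Cons.IH[OF p] component_edge_closed[OF C e st(1) x st(2)] by blast
  qed
qed auto

lemma finite_incident_edges:
  assumes "finite S" "S \<subseteq> verts G"
  shows "finite {e \<in> edges G. src G e \<in> S \<or> tgt G e \<in> S}"
proof -
  have "{e \<in> edges G. src G e \<in> S \<or> tgt G e \<in> S} = (\<Union>v\<in>S. {e \<in> edges G. src G e = v \<or> tgt G e = v})"
    by auto
  then show ?thesis using assms locally_finite by (auto intro!: finite_UN_I)
qed

text \<open>A path from a component to the fixed point \<open>w\<close> shows that the component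
  contains \<open>w\<close> or the midpoint of an edge incident with \<open>S\<close>. By local
  finiteness these are finitely many markers, and a marker lies in at most one component.\<close>

lemma finite_components:
  assumes S: "finite S" "S \<subseteq> verts G"
  shows "finite (components_minus G S)"
proof -
  let ?T = "{e \<in> edges G. src G e \<in> S \<or> tgt G e \<in> S}"
  let ?mid = "\<lambda>e. Inner e ((left G e + right G e) / 2)"
  obtain w where w: "w \<in> points G" "S \<noteq> {} \<longrightarrow> w \<in> Vertex ` S"
    using S verts_nonempty that[of "Vertex _"] by (cases "S = {}") (simp_all, blast+)
  have *: "w \<in> C \<or> (\<exists>e\<in>?T. ?mid e \<in> C)" if C: "C \<in> components_minus G S" for C
  proof -
    obtain x where x: "x \<in> C" "x \<in> points G" using component_nonempty[OF C] component_subset[OF C] by auto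
    obtain p where "is_path G x p w" using path_exists x w by blast
    then show ?thesis using component_path[OF C _ x(1)] by auto
  qed
  define c where "c z = (THE C. C \<in> components_minus G S \<and> z \<in> C)" for z
  have c: "c z = C" if "C \<in> components_minus G S" "z \<in> C" for C z
    unfolding c_def using that component_unique by (intro the_equality) auto
  have "components_minus G S \<subseteq> c ` insert w (?mid ` ?T)"
  proof
    fix C assume C: "C \<in> components_minus G S"
    then obtain z where "z \<in> insert w (?mid ` ?T)" "z \<in> C" using *[OF C] by auto
    then show "C \<in> c ` insert w (?mid ` ?T)" using c[OF C] by auto
  qed
  then show ?thesis
    by (rule finite_subset) (intro finite_imageI finite.insertI finite_incident_edges[OF S])
qed

subsection \<open>Rays and ends\<close>

lemma ray_verts: "ray G r \<Longrightarrow> r n \<in> verts G"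
  by (auto simp: ray_def)

text \<open>An injective sequence visits a finite set finitely often; after the last visit,
  consecutive vertices stay in one component.\<close>

lemma ray_tail_component:
  assumes r: "ray G r" and S: "finite S"
  obtains C where "C \<in> components_minus G S" "has_tail_in r C"
proof -
  have "finite (r -` S)" using r S by (intro finite_vimageI) (auto simp: ray_def)
  then obtain m where "\<forall>n\<in>r -` S. n < m" using finite_nat_set_iff_bounded by blast
  then have m: "r n \<notin> S" if "m \<le> n" for n using that by (meson leD vimageI2)
  obtain C where C: "C \<in> components_minus G S" "Vertex (r m) \<in> C"
    using component_exists[of "Vertex (r m)" S] m[of m] ray_verts[OF r] by auto
  have "Vertex (r n) \<in> C" if "m \<le> n" for n
    using that
  proof (induction rule: dec_induct)
    case (step n)
    then show ?case
      using component_adjacent[OF C(1), of "r n" "r (Suc n)"] m r by (auto simp: ray_def)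
  qed (rule C)
  then show thesis using C(1) that by (auto simp: has_tail_in_def)
qed

lemma has_tail_in_meet:
  assumes "has_tail_in r A" "has_tail_in r B"
  obtains n where "Vertex (r n) \<in> A" "Vertex (r n) \<in> B"
proof -
  obtain k l where "\<forall>n\<ge>k. Vertex (r n) \<in> A" "\<forall>n\<ge>l. Vertex (r n) \<in> B"
    using assms by (auto simp: has_tail_in_def)
  then show thesis using that[of "max k l"] by simp
qed

lemma has_tail_in_mono: "\<lbrakk>has_tail_in r A; A \<subseteq> B\<rbrakk> \<Longrightarrow> has_tail_in r B"
  by (auto simp: has_tail_in_def)

lemma ray_shift: "ray G r \<Longrightarrow> ray G (\<lambda>n. r (n + N))"
  unfolding ray_def by (auto intro!: injI dest: injD)

lemma has_tail_in_shift: "has_tail_in r C \<Longrightarrow> has_tail_in (\<lambda>n. r (n + N)) C"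
  unfolding has_tail_in_def by (metis trans_le_add1)

lemma end_equivD:
  assumes "(r, r') \<in> end_equiv G" "C \<in> components_minus G S" "finite S" "S \<subseteq> verts G"
    "has_tail_in r C"
  shows "has_tail_in r' C"
proof -
  obtain C' where C': "C' \<in> components_minus G S" "has_tail_in r C'" "has_tail_in r' C'"
    using assms by (auto simp: end_equiv_def)
  have "C' = C"
    using has_tail_in_meet[OF C'(2) assms(5)] component_unique[OF C'(1) assms(2)] by metis
  with C' show ?thesis by simp
qed

lemma equiv_end: "equiv (Collect (ray G)) (end_equiv G)"
proof (rule equivI)
  show "end_equiv G \<subseteq> Collect (ray G) \<times> Collect (ray G)" by (auto simp: end_equiv_def)
  show "refl_on (Collect (ray G)) (end_equiv G)"
  proof (rule refl_onI)
    fix r assume "r \<in> Collect (ray G)"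
    then have "ray G r" by simp
    then show "(r, r) \<in> end_equiv G"
      unfolding end_equiv_def by (auto elim: ray_tail_component)
  qed
  show "sym (end_equiv G)" unfolding end_equiv_def by (rule symI) blast
  show "trans (end_equiv G)"
  proof (rule transI)
    fix r s t assume rs: "(r, s) \<in> end_equiv G" and st: "(s, t) \<in> end_equiv G"
    show "(r, t) \<in> end_equiv G"
      unfolding end_equiv_def
    proof (clarify, intro conjI allI impI)
      fix S assume S: "finite S \<and> S \<subseteq> verts G"
      then obtain C where "C \<in> components_minus G S" "has_tail_in r C" "has_tail_in s C"
        using rs by (auto simp: end_equiv_def)
      then show "\<exists>C\<in>components_minus G S. has_tail_in r C \<and> has_tail_in t C"
        using end_equivD[OF st] S by blast
    qed (use rs st in \<open>auto simp: end_equiv_def\<close>)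
  qed
qed

lemma ends_class: "ray G r \<Longrightarrow> end_equiv G `` {r} \<in> ends G \<and> r \<in> end_equiv G `` {r}"
  unfolding ends_def using equiv_class_self[OF equiv_end] by (auto intro: quotientI)

lemma end_nonempty: assumes "\<omega> \<in> ends G" obtains r where "r \<in> \<omega>"
  using in_quotient_imp_non_empty[OF equiv_end, of \<omega>] assms unfolding ends_def by blast

lemma end_ray: "\<lbrakk>\<omega> \<in> ends G; r \<in> \<omega>\<rbrakk> \<Longrightarrow> ray G r"
  unfolding ends_def by (drule in_quotient_imp_subset[OF equiv_end]) blast

lemma end_related: "\<lbrakk>\<omega> \<in> ends G; r \<in> \<omega>; r' \<in> \<omega>\<rbrakk> \<Longrightarrow> (r, r') \<in> end_equiv G"
  unfolding ends_def by (rule in_quotient_imp_in_rel[OF equiv_end]) auto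

lemma end_closed: "\<lbrakk>\<omega> \<in> ends G; r \<in> \<omega>; (r, r') \<in> end_equiv G\<rbrakk> \<Longrightarrow> r' \<in> \<omega>"
  unfolding ends_def by (rule in_quotient_imp_closed[OF equiv_end])

lemma end_shift:
  assumes "\<omega> \<in> ends G" "r \<in> \<omega>"
  shows "(\<lambda>n. r (n + N)) \<in> \<omega>"
proof (rule end_closed[OF assms])
  have r: "ray G r" using assms by (rule end_ray)
  have "\<exists>C\<in>components_minus G S. has_tail_in r C \<and> has_tail_in (\<lambda>n. r (n + N)) C" if "finite S" for S
    by (rule ray_tail_component[OF r that]) (blast intro: has_tail_in_shift)
  with r show "(r, \<lambda>n. r (n + N)) \<in> end_equiv G"
    using ray_shift[OF r] by (simp add: end_equiv_def)
qed

text \<open>\<open>end_nbhd\<close> asks for a whole ray in \<open>C\<close>. A tail suffices,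
  because an end contains all shifts of its rays.\<close>

lemma Inr_end_nbhd_iff:
  assumes "\<omega> \<in> ends G"
  shows "Inr \<omega> \<in> end_nbhd G C \<longleftrightarrow> (\<exists>r\<in>\<omega>. has_tail_in r C)"
proof (rule iffI)
  assume "\<exists>r\<in>\<omega>. has_tail_in r C"
  then obtain r N where r: "r \<in> \<omega>" "\<forall>n\<ge>N. Vertex (r n) \<in> C" by (auto simp: has_tail_in_def)
  then show "Inr \<omega> \<in> end_nbhd G C"
    unfolding end_nbhd_def using end_shift[OF assms r(1), of N] assms
    by (intro UnI2 imageI CollectI conjI bexI[of _ "\<lambda>n. r (n + N)"]) auto
next
  assume "Inr \<omega> \<in> end_nbhd G C"
  then obtain r where "r \<in> \<omega>" "\<forall>n. Vertex (r n) \<in> C" by (auto simp: end_nbhd_def)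
  then show "\<exists>r\<in>\<omega>. has_tail_in r C" by (auto simp: has_tail_in_def)
qed

text \<open>Upgrades the existential choice of a representative to every representative, which
  allows one fixed ray to test several neighbourhoods.\<close>

lemma Inr_end_nbhd_all:
  assumes "Inr \<omega> \<in> end_nbhd G C" "C \<in> components_minus G S" "finite S" "S \<subseteq> verts G" "r \<in> \<omega>"
  shows "has_tail_in r C"
proof -
  have \<omega>: "\<omega> \<in> ends G" using assms(1) by (auto simp: end_nbhd_def)
  obtain r' where r': "r' \<in> \<omega>" "has_tail_in r' C" using assms(1) Inr_end_nbhd_iff[OF \<omega>] by auto
  show ?thesis by (rule end_equivD[OF end_related[OF \<omega> r'(1) assms(5)] assms(2-4) r'(2)])
qed

lemma Inl_end_nbhd_iff [simp]: "Inl x \<in> end_nbhd G C \<longleftrightarrow> x \<in> C"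
  by (auto simp: end_nbhd_def)

lemma end_nbhd_mono: "C \<subseteq> D \<Longrightarrow> end_nbhd G C \<subseteq> end_nbhd G D"
  unfolding end_nbhd_def
  by (intro Un_mono image_mono Collect_mono impI, assumption)
    (elim conjE bexE, intro conjI bexI allI, assumption, erule subsetD, erule spec)

lemma end_component:
  assumes "\<omega> \<in> ends G" "finite S" "S \<subseteq> verts G"
  obtains C where "C \<in> components_minus G S" "Inr \<omega> \<in> end_nbhd G C"
proof -
  obtain r where r: "r \<in> \<omega>" using end_nonempty assms by blast
  obtain C where "C \<in> components_minus G S" "has_tail_in r C"
    using ray_tail_component[OF end_ray[OF assms(1) r] assms(2)] .
  then show thesis by (intro that[of C]) (use Inr_end_nbhd_iff[OF assms(1)] r in auto)
qed

subsection \<open>The topology of the end compactification\<close>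

lemma openin_Inl_image:
  "openin (complex_topology G) U \<Longrightarrow> openin (end_compactification G) (Inl ` U)"
  unfolding end_compactification_def openin_topology_generated_by_iff
  by (intro generate_topology_on.Basis) auto

lemma openin_end_nbhd:
  "\<lbrakk>C \<in> components_minus G S; finite S; S \<subseteq> verts G\<rbrakk> \<Longrightarrow> openin (end_compactification G) (end_nbhd G C)"
  unfolding end_compactification_def openin_topology_generated_by_iff
  by (intro generate_topology_on.Basis) auto

lemma topspace_end_compactification:
  "topspace (end_compactification G) = Inl ` points G \<union> Inr ` ends G" (is "_ = ?R")
proof
  have "end_nbhd G C \<subseteq> ?R" if "C \<in> components_minus G S" for C S
    using component_subset[OF that] by (auto simp: end_nbhd_def)
  moreover have "Inl ` U \<subseteq> ?R" if "openin (complex_topology G) U" for U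
    using openin_subset[OF that] by auto
  ultimately show "topspace (end_compactification G) \<subseteq> ?R"
    unfolding end_compactification_def topology_generated_by_topspace by blast
  have "Inl ` points G \<subseteq> topspace (end_compactification G)"
    using openin_subset[OF openin_Inl_image[OF openin_topspace]] by simp
  moreover have "Inr ` ends G \<subseteq> topspace (end_compactification G)"
  proof clarify
    fix \<omega> assume "\<omega> \<in> ends G"
    then obtain C where "C \<in> components_minus G {}" "Inr \<omega> \<in> end_nbhd G C"
      using end_component[of \<omega> "{}"] by auto
    then show "Inr \<omega> \<in> topspace (end_compactification G)"
      using openin_subset[OF openin_end_nbhd] by blast
  qed
  ultimately show "?R \<subseteq> topspace (end_compactification G)" by blast
qed

lemma openin_end_Inl_vimage:
  assumes "openin (end_compactification G) N"
  shows "openin (complex_topology G) (Inl -` N)"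
  using assms unfolding end_compactification_def openin_topology_generated_by_iff
proof (induction rule: generate_topology_on.induct)
  case (Int a b)
  then show ?case by (simp add: vimage_Int openin_Int)
next
  case (UN K)
  then show ?case unfolding vimage_Union by (blast intro: openin_Union)
next
  case (Basis s)
  then consider U where "s = Inl ` U" "openin (complex_topology G) U"
    | C S where "s = end_nbhd G C" "C \<in> components_minus G S" by auto
  then show ?case
  proof cases
    case (1 U)
    then show ?thesis by (simp add: inj_vimage_image_eq)
  next
    case (2 C S)
    then have "Inl -` s = C" by auto
    then show ?thesis using openin_component 2 by simp
  qed
qed auto

text \<open>The topology is given by a subbasis only. For an intersection of neighbourhoods
  belonging to \<open>S\<close> and \<open>S'\<close>, take the component \<open>D\<close> of the
  end for \<open>S \<union> S'\<close>: it shares a ray vertex with each of the two components and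
  hence lies in both.\<close>

lemma end_nbhd_basis:
  assumes "openin (end_compactification G) N" "Inr \<omega> \<in> N"
  obtains C S where "C \<in> components_minus G S" "finite S" "S \<subseteq> verts G"
    "Inr \<omega> \<in> end_nbhd G C" "end_nbhd G C \<subseteq> N"
proof -
  have "Inr \<omega> \<in> N \<longrightarrow> (\<exists>C S. C \<in> components_minus G S \<and> finite S \<and> S \<subseteq> verts G \<and>
    Inr \<omega> \<in> end_nbhd G C \<and> end_nbhd G C \<subseteq> N)"
    using assms(1) unfolding end_compactification_def openin_topology_generated_by_iff
  proof (induction rule: generate_topology_on.induct)
    case (Int a b)
    show ?case
    proof
      assume "Inr \<omega> \<in> a \<inter> b"
      then obtain C S C' S' where
        C: "C \<in> components_minus G S" "finite S" "S \<subseteq> verts G" "Inr \<omega> \<in> end_nbhd G C" "end_nbhd G C \<subseteq> a"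
        and C': "C' \<in> components_minus G S'" "finite S'" "S' \<subseteq> verts G" "Inr \<omega> \<in> end_nbhd G C'"
          "end_nbhd G C' \<subseteq> b"
        using Int.IH by auto
      have \<omega>: "\<omega> \<in> ends G" using C(4) by (auto simp: end_nbhd_def)
      obtain D where D: "D \<in> components_minus G (S \<union> S')" "Inr \<omega> \<in> end_nbhd G D"
        using end_component[OF \<omega>, of "S \<union> S'"] C C' by auto
      obtain r where r: "r \<in> \<omega>" using end_nonempty \<omega> by blast
      have t: "has_tail_in r D" "has_tail_in r C" "has_tail_in r C'"
        using r C C' D by (auto intro: Inr_end_nbhd_all)
      have "D \<subseteq> C" "D \<subseteq> C'"
        using has_tail_in_meet[OF t(1,2)] has_tail_in_meet[OF t(1,3)]
          component_mono[OF D(1) C(1)] component_mono[OF D(1) C'(1)] by (metis Un_upper1 Un_upper2)+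
      then show "\<exists>C S. C \<in> components_minus G S \<and> finite S \<and> S \<subseteq> verts G \<and>
          Inr \<omega> \<in> end_nbhd G C \<and> end_nbhd G C \<subseteq> a \<inter> b"
        using D C C' end_nbhd_mono[of D] by (intro exI[of _ D] exI[of _ "S \<union> S'"]) blast
    qed
  next
    case (UN K)
    then show ?case by (meson Union_iff Union_upper order_trans)
  qed auto
  then show thesis using assms(2) that by blast
qed

section \<open>Extending open sets and partitions of the graph to the ends\<close>

text \<open>For open \<open>P\<close> this is the largest open subset of the end compactification
  whose trace on the graph is \<open>P\<close>. Writing it as a union of basic sets makes openness
  immediate.\<close>

definition end_hull :: "('v, 'e) gpoint set \<Rightarrow> (('v, 'e) gpoint + (nat \<Rightarrow> 'v) set) set" where
  "end_hull P = Inl ` P \<union>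
     \<Union>{end_nbhd G C |C S. C \<in> components_minus G S \<and> finite S \<and> S \<subseteq> verts G \<and> C \<subseteq> P}"

lemma Inl_end_hull_iff [simp]: "Inl x \<in> end_hull P \<longleftrightarrow> x \<in> P"
  by (auto simp: end_hull_def)

lemma Inr_end_hullE:
  assumes "Inr \<omega> \<in> end_hull P"
  obtains C S where "C \<in> components_minus G S" "finite S" "S \<subseteq> verts G" "C \<subseteq> P"
    "Inr \<omega> \<in> end_nbhd G C"
  using assms by (auto simp: end_hull_def)

lemma Inr_end_hull_ray:
  assumes "Inr \<omega> \<in> end_hull P" "r \<in> \<omega>"
  shows "has_tail_in r P"
proof -
  obtain C S where "C \<in> components_minus G S" "finite S" "S \<subseteq> verts G" "C \<subseteq> P" "Inr \<omega> \<in> end_nbhd G C"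
    using assms(1) by (rule Inr_end_hullE)
  then show ?thesis using Inr_end_nbhd_all assms(2) has_tail_in_mono by blast
qed

lemma openin_end_hull:
  "openin (complex_topology G) P \<Longrightarrow> openin (end_compactification G) (end_hull P)"
  unfolding end_hull_def
  by (intro openin_Un openin_Inl_image openin_Union) (auto intro: openin_end_nbhd)

text \<open>A ray of a common end would have tails in both \<open>P\<close> and
  \<open>Q\<close>.\<close>

lemma disjnt_end_hull:
  assumes "disjnt P Q" shows "disjnt (end_hull P) (end_hull Q)"
  unfolding disjnt_iff
proof (intro allI notI, elim conjE)
  fix z assume z: "z \<in> end_hull P" "z \<in> end_hull Q"
  show False
  proof (cases z)
    case (Inl x)
    then show False using z assms by (auto simp: disjnt_iff)
  next
    case (Inr \<omega>)
    have "\<omega> \<in> ends G" using z(1) Inr by (auto simp: end_hull_def end_nbhd_def)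
    then obtain r where "r \<in> \<omega>" using end_nonempty by blast
    then have "has_tail_in r P" "has_tail_in r Q" using Inr_end_hull_ray z Inr by auto
    then show False using has_tail_in_meet assms by (metis disjnt_iff)
  qed
qed

lemma end_hull_cut:
  assumes PQ: "openin (complex_topology G) P" "openin (complex_topology G) Q" "disjnt P Q"
    and W: "finite W" "W \<subseteq> points G" "P \<union> Q = points G - W"
  shows "end_hull P \<union> end_hull Q = topspace (end_compactification G) - Inl ` W"
proof (intro equalityI subsetI)
  fix z assume "z \<in> end_hull P \<union> end_hull Q"
  moreover have "end_hull P \<union> end_hull Q \<subseteq> topspace (end_compactification G)"
    using openin_subset[OF openin_end_hull] PQ by simp
  moreover have "z \<noteq> Inl w" if "w \<in> W" for w using \<open>z \<in> _\<close> that W by auto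
  ultimately show "z \<in> topspace (end_compactification G) - Inl ` W" by blast
next
  fix z assume z: "z \<in> topspace (end_compactification G) - Inl ` W"
  show "z \<in> end_hull P \<union> end_hull Q"
  proof (cases z)
    case (Inl x)
    then show ?thesis using z W by (auto simp: topspace_end_compactification)
  next
    case (Inr \<omega>)
    then have \<omega>: "\<omega> \<in> ends G" using z by (auto simp: topspace_end_compactification)
    \<comment> \<open>Removing the vertices of \<open>W\<close> and both endpoints of every edge
      with an inner point in \<open>W\<close> confines each component that meets \<open>W\<close> to
      a single edge. The component \<open>C\<close> of the end contains a vertex of a ray, so it
      misses \<open>W\<close> and, being connected, falls on one side.\<close>
    define S where "S = (\<Union>w\<in>W. case w of Vertex v \<Rightarrow> {v} | Inner e t \<Rightarrow> {src G e, tgt G e})"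
    have S: "finite S" "S \<subseteq> verts G"
      using W src_in_verts tgt_in_verts unfolding S_def
      by (auto split: gpoint.splits dest!: subsetD)
    obtain C where C: "C \<in> components_minus G S" "Inr \<omega> \<in> end_nbhd G C"
      using end_component[OF \<omega> S] by blast
    obtain r where r: "r \<in> \<omega>" using end_nonempty \<omega> by blast
    then obtain n where n: "Vertex (r n) \<in> C"
      using Inr_end_nbhd_all[OF C(2,1) S] by (auto simp: has_tail_in_def)
    have "C \<inter> W = {}"
    proof (rule ccontr)
      assume "C \<inter> W \<noteq> {}"
      then obtain w where w: "w \<in> C" "w \<in> W" by auto
      show False
      proof (cases w)
        case (Vertex v)
        then have "v \<in> S" using w by (force simp: S_def)
        then show False using component_subset[OF C(1)] w Vertex by auto
      next
        case (Inner e t)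
        then have "src G e \<in> S" "tgt G e \<in> S" using w by (force simp: S_def)+
        then show False using component_within_edge[OF C(1)] w Inner n by auto
      qed
    qed
    then have "C \<subseteq> P \<union> Q" using component_subset[OF C(1)] W by auto
    then have "C \<subseteq> P \<or> C \<subseteq> Q"
      using connectedinD[OF component_connected[OF C(1)] PQ(1,2)] PQ(3)
      by (auto simp: disjnt_iff)
    then show ?thesis using C S Inr unfolding end_hull_def by blast
  qed
qed

subsection \<open>Separation by inner points of edges\<close>

definition midpoint_param :: "'e \<Rightarrow> real" where
  "midpoint_param e = (left G e + right G e) / 2"

lemma midpoint_param_bounds:
  "e \<in> edges G \<Longrightarrow> left G e < midpoint_param e \<and> midpoint_param e < right G e"
  using left_less_right[of e] by (simp add: midpoint_param_def)

text \<open>An open neighbourhood of \<open>A\<close> in the graph: edges inside \<open>A\<close>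
  are kept whole, and an edge leaving \<open>A\<close> is cut at its midpoint. The regions of
  \<open>A\<close> and of its complement in the vertex set thus leave out just the midpoints of the
  edges between them.\<close>

definition region :: "'v set \<Rightarrow> ('v, 'e) gpoint set" where
  "region A = {x \<in> points G. case x of Vertex v \<Rightarrow> v \<in> A
     | Inner e t \<Rightarrow> (src G e \<in> A \<and> (tgt G e \<in> A \<or> t < midpoint_param e)) \<or>
         (tgt G e \<in> A \<and> midpoint_param e < t)}"

lemma edge_point_in_region:
  assumes e: "e \<in> edges G" and t: "t \<in> {left G e..right G e}"
  shows "edge_point G e t \<in> region A \<longleftrightarrow>
    (src G e \<in> A \<and> (tgt G e \<in> A \<or> t < midpoint_param e)) \<or> (tgt G e \<in> A \<and> midpoint_param e < t)"
  using midpoint_param_bounds[OF e] e src_in_verts[OF e] tgt_in_verts[OF e]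
  by (cases rule: edge_param_cases[OF e t]) (auto simp: region_def)

lemma openin_region: "openin (complex_topology G) (region A)"
proof (unfold openin_complex_topology, intro conjI ballI)
  fix e assume e: "e \<in> edges G"
  let ?I = "{left G e..right G e}"
  let ?U = "if src G e \<in> A then if tgt G e \<in> A then UNIV else {..<midpoint_param e}
    else if tgt G e \<in> A then {midpoint_param e<..} else {}"
  have "edge_point G e t \<in> region A \<longleftrightarrow> t \<in> ?U" if "t \<in> ?I" for t
    unfolding edge_point_in_region[OF e that] by simp
  then have "{t \<in> ?I. edge_point G e t \<in> region A} = ?I \<inter> ?U" by blast
  moreover have "open ?U" by simp
  ultimately show "openin (top_of_set ?I) {t \<in> ?I. edge_point G e t \<in> region A}"
    by (simp only: openin_open_Int)
qed (auto simp: region_def)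

text \<open>The cut is kept inside the graph so that it can be used on both sides of the
  homeomorphism. Vertices are excluded from \<open>W\<close> because only inner points of edges are
  known to be mapped into the graph by \<open>homeomorphic_map_Inner\<close>.\<close>

definition end_separated ::
  "('v, 'e) gpoint + (nat \<Rightarrow> 'v) set \<Rightarrow> ('v, 'e) gpoint + (nat \<Rightarrow> 'v) set \<Rightarrow> bool" where
  "end_separated z z' \<longleftrightarrow> (\<exists>W P Q. finite W \<and> W \<subseteq> points G - range Vertex \<and>
     openin (complex_topology G) P \<and> openin (complex_topology G) Q \<and> disjnt P Q \<and>
     P \<union> Q = points G - W \<and> z \<in> end_hull P \<and> z' \<in> end_hull Q)"

lemma end_separated_sym: "end_separated z z' \<Longrightarrow> end_separated z' z"
  unfolding end_separated_def by (metis Un_commute disjnt_sym)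

text \<open>The two hulls cover everything outside \<open>W\<close>, so it is enough to keep each
  point out of the wrong hull. For an end this exclusion can be tested on a single ray.\<close>

lemma end_separatedI:
  assumes "openin (complex_topology G) P" "openin (complex_topology G) Q" "disjnt P Q"
    and "finite W" "W \<subseteq> points G - range Vertex" "P \<union> Q = points G - W"
    and z: "z \<in> topspace (end_compactification G)" "z \<notin> Inl ` W" "z \<notin> end_hull Q"
    and z': "z' \<in> topspace (end_compactification G)" "z' \<notin> Inl ` W" "z' \<notin> end_hull P"
  shows "end_separated z z'"
proof -
  have "end_hull P \<union> end_hull Q = topspace (end_compactification G) - Inl ` W"
    using assms(5) by (intro end_hull_cut assms) auto
  then have "z \<in> end_hull P" "z' \<in> end_hull Q" using z z' by blast+
  then show ?thesis unfolding end_separated_def using assms(1-6) by blast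
qed

text \<open>The cut set consists of the midpoints of the edges leaving \<open>A\<close>. Inner
  points of edges are not allowed as \<open>z\<close> or \<open>z'\<close>, since they might be such
  midpoints.\<close>

lemma region_separated:
  assumes A: "A \<subseteq> verts G" "finite {e \<in> edges G. (src G e \<in> A) \<noteq> (tgt G e \<in> A)}"
    and z: "z \<in> topspace (end_compactification G)" "z \<notin> Inl ` (- range Vertex)"
      "z \<notin> end_hull (region (verts G - A))"
    and z': "z' \<in> topspace (end_compactification G)" "z' \<notin> Inl ` (- range Vertex)"
      "z' \<notin> end_hull (region A)"
  shows "end_separated z z'"
proof -
  let ?W = "(\<lambda>e. Inner e (midpoint_param e)) ` {e \<in> edges G. (src G e \<in> A) \<noteq> (tgt G e \<in> A)}"
  have W: "?W \<subseteq> points G - range Vertex" using midpoint_param_bounds by auto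
  show ?thesis
  proof (rule end_separatedI[OF openin_region openin_region _ _ W])
    show "disjnt (region A) (region (verts G - A))"
      unfolding disjnt_iff region_def by (auto split: gpoint.splits)
    show "region A \<union> region (verts G - A) = points G - ?W"
    proof (intro equalityI subsetI)
      fix x assume "x \<in> region A \<union> region (verts G - A)"
      then show "x \<in> points G - ?W" by (cases x) (auto simp: region_def)
    next
      fix x assume "x \<in> points G - ?W"
      then show "x \<in> region A \<union> region (verts G - A)"
        using src_in_verts tgt_in_verts by (cases x) (auto simp: region_def)
    qed
  qed (use A z z' in auto)
qed

lemma end_separated_Inner:
  assumes x: "Inner e t \<in> points G" and z': "z' \<in> topspace (end_compactification G)" "z' \<noteq> Inl (Inner e t)"
  shows "end_separated (Inl (Inner e t)) z'"
proof -
  have e: "e \<in> edges G" and t: "left G e < t" "t < right G e" using x by auto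
  obtain d where d: "0 < d" "left G e < t - d" "t + d < right G e" "z' \<notin> Inl ` Inner e ` {t - d..t + d}"
  proof -
    \<comment> \<open>Only a point \<open>z'\<close> on the same edge matters, and then
      \<open>t'\<close> differs from \<open>t\<close>. The value 1 keeps \<open>k\<close> positive
      in all other cases. Halving in \<open>d\<close> makes the closed interval around
      \<open>t\<close> stay strictly inside the edge and miss \<open>z'\<close>.\<close>
    define k where "k = (case z' of Inl (Inner e' t') \<Rightarrow> (if t' = t then 1 else \<bar>t' - t\<bar>) | _ \<Rightarrow> 1)"
    define d where "d = min (min (t - left G e) (right G e - t)) k / 2"
    have k: "0 < k" by (auto simp: k_def split: sum.splits gpoint.splits)
    then have d: "0 < d" "d < t - left G e" "d < right G e - t" "d < k" using t by (auto simp: d_def)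
    moreover have "z' \<notin> Inl ` Inner e ` {t - d..t + d}"
    proof
      assume "z' \<in> Inl ` Inner e ` {t - d..t + d}"
      then obtain t' where t': "z' = Inl (Inner e t')" "\<bar>t' - t\<bar> \<le> d" by auto
      then have "k = \<bar>t' - t\<bar>" using z' by (auto simp: k_def)
      with t' d show False by simp
    qed
    ultimately show thesis by (intro that[of d]) auto
  qed
  let ?P = "Inner e ` ({left G e<..<right G e} \<inter> {t - d<..<t + d})"
  let ?Q = "points G - Inner e ` {t - d..t + d}"
  let ?W = "{Inner e (t - d), Inner e (t + d)}"
  have W: "?W \<subseteq> points G - range Vertex" using e d by auto
  have P: "?P \<subseteq> Inner e ` {t - d..t + d}" by auto
  \<comment> \<open>A piece of an open edge contains no vertex, hence no tail of a ray.\<close>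
  have Inr_P: "Inr \<omega> \<notin> end_hull ?P" if \<omega>: "Inr \<omega> \<in> topspace (end_compactification G)" for \<omega>
  proof
    assume *: "Inr \<omega> \<in> end_hull ?P"
    have "\<omega> \<in> ends G" using \<omega> by (auto simp: topspace_end_compactification)
    then obtain r where r: "r \<in> \<omega>" by (rule end_nonempty)
    show False using Inr_end_hull_ray[OF * r] by (auto simp: has_tail_in_def)
  qed
  have Q: "openin (complex_topology G) ?Q"
  proof (unfold openin_complex_topology, intro conjI ballI)
    fix e' assume e': "e' \<in> edges G"
    let ?I = "{left G e'..right G e'}" and ?U = "if e' = e then - {t - d..t + d} else UNIV"
    have "edge_point G e' s \<in> ?Q \<longleftrightarrow> s \<in> ?U" if "s \<in> ?I" for s
      using d edge_point_in[OF e' that] by (cases rule: edge_param_cases[OF e' that]) auto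
    then have "{s \<in> ?I. edge_point G e' s \<in> ?Q} = ?I \<inter> ?U" by blast
    moreover have "open ?U" by (simp add: open_Compl)
    ultimately show "openin (top_of_set ?I) {s \<in> ?I. edge_point G e' s \<in> ?Q}"
      by (simp only: openin_open_Int)
  qed auto
  have P': "openin (complex_topology G) ?P" by (intro openin_complex_Inner_image e) simp
  show ?thesis
  proof (rule end_separatedI[OF P' Q _ _ W])
    show "disjnt ?P ?Q" by (auto simp: disjnt_iff)
    show "?P \<union> ?Q = points G - ?W"
    proof (intro equalityI subsetI)
      fix x assume "x \<in> ?P \<union> ?Q"
      then show "x \<in> points G - ?W" using e d(1) by (auto simp: image_iff)
    next
      fix x assume "x \<in> points G - ?W"
      then show "x \<in> ?P \<union> ?Q" using d by (cases x) auto
    qed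
    show "z' \<notin> Inl ` ?W" using d by auto
    show "z' \<notin> end_hull ?P"
    proof (cases z')
      case (Inl y)
      then have "y \<notin> Inner e ` {t - d..t + d}" using d(4) by blast
      then show ?thesis using P unfolding Inl Inl_end_hull_iff by blast
    next
      case (Inr \<omega>)
      then show ?thesis using Inr_P z' by blast
    qed
  qed (use x d z' in \<open>auto simp: topspace_end_compactification\<close>)
qed

text \<open>Cut the edges leaving \<open>v\<close> at their midpoints. The only vertex on the side
  of \<open>v\<close> is \<open>v\<close> itself, and an injective ray cannot stay there.\<close>

lemma end_separated_Vertex:
  assumes v: "v \<in> verts G" and z': "z' \<in> topspace (end_compactification G)"
    "z' \<notin> Inl ` (- range Vertex)" "z' \<noteq> Inl (Vertex v)"
  shows "end_separated (Inl (Vertex v)) z'"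
proof (rule region_separated[where A = "{v}"])
  show "finite {e \<in> edges G. (src G e \<in> {v}) \<noteq> (tgt G e \<in> {v})}"
    by (rule finite_subset[OF _ locally_finite[OF v]]) auto
  show "z' \<notin> end_hull (region {v})"
  proof (cases z')
    case (Inl x)
    then show ?thesis using z' by (cases x) (auto simp: region_def)
  next
    case (Inr \<omega>)
    then have \<omega>: "\<omega> \<in> ends G" using z' by (auto simp: topspace_end_compactification)
    then obtain r where r: "r \<in> \<omega>" using end_nonempty by blast
    show ?thesis
    proof
      assume "z' \<in> end_hull (region {v})"
      then have "has_tail_in r (region {v})" using Inr_end_hull_ray r Inr by blast
      then obtain N where N: "\<forall>n\<ge>N. Vertex (r n) \<in> region {v}" by (auto simp: has_tail_in_def)
      have "r N = r (Suc N)" using N[rule_format, of N] N[rule_format, of "Suc N"] by (simp add: region_def)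
      then show False using end_ray[OF \<omega> r] by (auto simp: ray_def dest: injD)
    qed
  qed
qed (use v z' in \<open>auto simp: topspace_end_compactification region_def\<close>)

text \<open>Some finite \<open>S\<close> puts tails of the two rays into different components. Take
  for \<open>A\<close> the vertices of the first component: every edge leaving \<open>A\<close> is
  incident with \<open>S\<close>, so there are only finitely many to cut.\<close>

lemma end_separated_ends:
  assumes \<omega>: "\<omega> \<in> ends G" "\<omega>' \<in> ends G" "\<omega> \<noteq> \<omega>'"
  shows "end_separated (Inr \<omega>) (Inr \<omega>')"
proof -
  obtain r r' where r: "r \<in> \<omega>" "r' \<in> \<omega>'" using end_nonempty \<omega> by metis
  have rays: "ray G r" "ray G r'" using end_ray \<omega> r by auto
  have "(r, r') \<notin> end_equiv G"
    using r \<omega> quotient_eq_iff[OF equiv_end, of \<omega> \<omega>' r r'] unfolding ends_def by auto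
  then obtain S where S: "finite S" "S \<subseteq> verts G"
    "\<not> (\<exists>C\<in>components_minus G S. has_tail_in r C \<and> has_tail_in r' C)"
    using rays by (auto simp: end_equiv_def)
  obtain C where C: "C \<in> components_minus G S" "has_tail_in r C"
    using ray_tail_component[OF rays(1) S(1)] .
  obtain C' where C': "C' \<in> components_minus G S" "has_tail_in r' C'"
    using ray_tail_component[OF rays(2) S(1)] .
  define A where "A = {v. Vertex v \<in> C}"
  have in_A: "Vertex v \<in> region A \<longleftrightarrow> Vertex v \<in> C" for v
    using component_subset[OF C(1)] by (auto simp: region_def A_def)
  have out_A: "Vertex v \<in> region (verts G - A) \<Longrightarrow> Vertex v \<notin> C" for v
    by (auto simp: region_def A_def)
  show ?thesis
  proof (rule region_separated[where A = A])
    show "A \<subseteq> verts G" using component_subset[OF C(1)] by (auto simp: A_def)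
    have "src G e \<in> S \<or> tgt G e \<in> S" if "e \<in> edges G" "(src G e \<in> A) \<noteq> (tgt G e \<in> A)" for e
    proof -
      have "adjacent G (src G e) (tgt G e)" "adjacent G (tgt G e) (src G e)"
        using that(1) unfolding adjacent_def by (auto intro: bexI[of _ e])
      then show ?thesis using component_adjacent[OF C(1)] that(2) unfolding A_def by blast
    qed
    then show "finite {e \<in> edges G. (src G e \<in> A) \<noteq> (tgt G e \<in> A)}"
      by (intro finite_subset[OF _ finite_incident_edges[OF S(1,2)]]) auto
    show "Inr \<omega> \<notin> end_hull (region (verts G - A))"
    proof
      assume "Inr \<omega> \<in> end_hull (region (verts G - A))"
      then have "has_tail_in r (region (verts G - A))" using Inr_end_hull_ray r by blast
      then show False using has_tail_in_meet[OF C(2)] out_A by metis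
    qed
    show "Inr \<omega>' \<notin> end_hull (region A)"
    proof
      assume "Inr \<omega>' \<in> end_hull (region A)"
      then have "has_tail_in r' (region A)" using Inr_end_hull_ray r by blast
      then obtain n where n: "Vertex (r' n) \<in> C" "Vertex (r' n) \<in> C'"
        using has_tail_in_meet[OF C'(2)] in_A by metis
      have "C = C'" by (rule component_unique[OF C(1) C'(1) n])
      then show False using C C' S(3) by blast
    qed
  qed (use \<omega> in \<open>auto simp: topspace_end_compactification\<close>)
qed

lemma end_separation:
  assumes z: "z \<in> topspace (end_compactification G)" "z' \<in> topspace (end_compactification G)" "z \<noteq> z'"
  shows "end_separated z z'"
proof -
  have inner: "end_separated z z'" if "z \<in> Inl ` (- range Vertex)"
    "z \<in> topspace (end_compactification G)" "z' \<in> topspace (end_compactification G)" "z \<noteq> z'" for z z'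
  proof -
    from that(1) obtain x where x: "z = Inl x" "x \<notin> range Vertex" by auto
    then obtain e t where "x = Inner e t" by (cases x) auto
    with x that show ?thesis
      by (auto intro!: end_separated_Inner simp: topspace_end_compactification)
  qed
  have vertex: "end_separated (Inl x) z'" if x: "x \<in> range Vertex" and "z' \<notin> Inl ` (- range Vertex)"
    "Inl x \<in> topspace (end_compactification G)" "z' \<in> topspace (end_compactification G)" "Inl x \<noteq> z'"
    for x z'
  proof -
    obtain v where "x = Vertex v" using x by blast
    moreover from this that have "v \<in> verts G" by (auto simp: topspace_end_compactification)
    ultimately show ?thesis using end_separated_Vertex that by blast
  qed
  show ?thesis
  proof (cases "z \<in> Inl ` (- range Vertex) \<or> z' \<in> Inl ` (- range Vertex)")
    case True
    then show ?thesis using inner[of z z'] inner[of z' z] end_separated_sym z by auto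
  next
    case False
    show ?thesis
    proof (cases z)
      case (Inl x)
      then show ?thesis using vertex[of x z'] False z by auto
    next
      case z\<omega>: (Inr \<omega>)
      show ?thesis
      proof (cases z')
        case (Inl x)
        then show ?thesis using vertex[of x z] False z end_separated_sym by auto
      next
        case (Inr \<omega>')
        then show ?thesis using z z\<omega> end_separated_ends by (auto simp: topspace_end_compactification)
      qed
    qed
  qed
qed

subsection \<open>Compactness of the end compactification\<close>

lemma adjacent_sym: "adjacent G u v \<Longrightarrow> adjacent G v u"
  by (auto simp: adjacent_def insert_commute)

lemma adjacent_verts: "adjacent G u v \<Longrightarrow> u \<in> verts G \<and> v \<in> verts G"
  using src_in_verts tgt_in_verts by (auto simp: adjacent_def doubleton_eq_iff)

lemma finite_neighbours: assumes "u \<in> verts G" shows "finite {v. adjacent G u v}"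
proof (rule finite_subset)
  let ?T = "{e \<in> edges G. src G e = u \<or> tgt G e = u}"
  show "{v. adjacent G u v} \<subseteq> src G ` ?T \<union> tgt G ` ?T"
    by (auto simp: adjacent_def doubleton_eq_iff)
  show "finite (src G ` ?T \<union> tgt G ` ?T)" using locally_finite[OF assms] by auto
qed

text \<open>\<open>lv\<close> is the combinatorial distance from a root, ignoring edge lengths.
  Balls are finite by induction on the radius, each vertex having finitely many neighbours.\<close>

lemma level_function:
  obtains v0 and lv :: "'v \<Rightarrow> nat"
  where "v0 \<in> verts G" "lv v0 = 0" "\<And>v. \<lbrakk>v \<in> verts G; lv v = 0\<rbrakk> \<Longrightarrow> v = v0"
    "\<And>v k. \<lbrakk>v \<in> verts G; lv v = Suc k\<rbrakk> \<Longrightarrow> \<exists>u. adjacent G u v \<and> lv u = k"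
    "\<And>m. finite {v \<in> verts G. lv v \<le> m}"
proof -
  obtain v0 where v0: "v0 \<in> verts G" using verts_nonempty by auto
  define lv where "lv v = (LEAST n. (adjacent G ^^ n) v0 v)" for v
  have lv: "(adjacent G ^^ lv v) v0 v" if v: "v \<in> verts G" for v
  proof -
    obtain n where "(adjacent G ^^ n) v0 v"
      using rtranclp_imp_relpowp[OF connected_graph[OF v0 v]] by blast
    then show ?thesis unfolding lv_def by (rule LeastI)
  qed
  have lv_le: "lv v \<le> n" if "(adjacent G ^^ n) v0 v" for v n
    unfolding lv_def using that by (rule Least_le)
  have pred: "\<exists>u. adjacent G u v \<and> lv u = k" if v: "v \<in> verts G" "lv v = Suc k" for v k
  proof -
    have "(adjacent G ^^ Suc k) v0 v" using lv[OF v(1)] v(2) by simp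
    then obtain u where u: "(adjacent G ^^ k) v0 u" "adjacent G u v" by (rule relpowp_Suc_E)
    have "(adjacent G ^^ Suc (lv u)) v0 v"
      using lv[of u] u(2) adjacent_verts[OF u(2)] by (intro relpowp_Suc_I) auto
    then have "Suc k \<le> Suc (lv u)" using lv_le v(2) by metis
    then show ?thesis using lv_le[OF u(1)] u(2) by (intro exI[of _ u]) auto
  qed
  have zero: "v = v0" if v: "v \<in> verts G" "lv v = 0" for v
    using lv[OF v(1)] unfolding v(2) by simp
  have fin: "finite {v \<in> verts G. lv v \<le> m}" for m
  proof (induction m)
    case 0
    have "{v \<in> verts G. lv v \<le> 0} \<subseteq> {v0}" using zero by auto
    then show ?case by (rule finite_subset) simp
  next
    case (Suc m)
    let ?B = "{v \<in> verts G. lv v \<le> m}"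
    have "{v \<in> verts G. lv v \<le> Suc m} \<subseteq> ?B \<union> (\<Union>u\<in>?B. {v. adjacent G u v})"
    proof
      fix v assume v: "v \<in> {v \<in> verts G. lv v \<le> Suc m}"
      show "v \<in> ?B \<union> (\<Union>u\<in>?B. {v. adjacent G u v})"
      proof (cases "lv v = Suc m")
        case True
        then obtain u where u: "adjacent G u v" "lv u = m" using pred[of v m] v by auto
        then have "u \<in> ?B" using adjacent_verts[OF u(1)] by simp
        then show ?thesis using u by blast
      qed (use v in auto)
    qed
    moreover have "finite (?B \<union> (\<Union>u\<in>?B. {v. adjacent G u v}))"
      using Suc.IH finite_neighbours by (intro finite_UnI finite_UN_I) auto
    ultimately show ?case by (rule finite_subset)
  qed
  have "lv v0 = 0" using lv_le[of 0 v0] by simp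
  then show thesis using that[of v0 lv] v0 zero pred fin by blast
qed

lemma continuous_Inl: "continuous_map (complex_topology G) (end_compactification G) Inl"
  unfolding continuous_map_def
proof (intro conjI allI impI)
  fix U :: "(('v, 'e) gpoint + (nat \<Rightarrow> 'v) set) set"
  assume "openin (end_compactification G) U"
  then have *: "openin (complex_topology G) (Inl -` U)" by (rule openin_end_Inl_vimage)
  then have "{x \<in> topspace (complex_topology G). Inl x \<in> U} = Inl -` U"
    using openin_subset[OF *] by auto
  with * show "openin (complex_topology G) {x \<in> topspace (complex_topology G). Inl x \<in> U}" by simp
qed (auto simp: topspace_end_compactification)

text \<open>A cover without finite subcover has, for every \<open>m\<close>, a component beyond the ball of radius
  \<open>m\<close> that is not finitely covered. Koenig's lemma in the breadth-first search tree then
  yields a ray through such components, and the cover fails near the end of this ray.\<close>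

lemma compact_end_compactification: "compact_space (end_compactification G)"
  unfolding compact_space_def compactin_def
proof (intro conjI allI impI)
  let ?E = "end_compactification G"
  fix \<U> assume "Ball \<U> (openin ?E) \<and> topspace ?E \<subseteq> \<Union>\<U>"
  then have op: "\<And>U. U \<in> \<U> \<Longrightarrow> openin ?E U" and cover: "topspace ?E \<subseteq> \<Union>\<U>" by auto
  define good where "good A \<longleftrightarrow> (\<exists>\<F>. finite \<F> \<and> \<F> \<subseteq> \<U> \<and> A \<subseteq> \<Union>\<F>)" for A
  have good_mono: "good A" if "good B" "A \<subseteq> B" for A B
    using that unfolding good_def by blast
  have good_single: "good A" if "A \<subseteq> U" "U \<in> \<U>" for A U
    unfolding good_def using that by (intro exI[of _ "{U}"]) auto
  have good_Un: "good (A \<union> B)" if AB: "good A" "good B" for A B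
  proof -
    obtain \<F> \<F>' where "finite \<F>" "\<F> \<subseteq> \<U>" "A \<subseteq> \<Union>\<F>" "finite \<F>'" "\<F>' \<subseteq> \<U>" "B \<subseteq> \<Union>\<F>'"
      using AB unfolding good_def by blast
    then show ?thesis unfolding good_def by (intro exI[of _ "\<F> \<union> \<F>'"]) auto
  qed
  have good_Union: "good (\<Union>\<A>)" if "finite \<A>" "\<And>A. A \<in> \<A> \<Longrightarrow> good A" for \<A>
    using that
  proof (induction \<A> rule: finite_induct)
    case empty
    then show ?case unfolding good_def by (intro exI[of _ "{}"]) auto
  next
    case (insert A \<A>)
    then show ?case using good_Un[of A "\<Union>\<A>"] by auto
  qed
  have good_compact: "good A" if "compactin ?E A" for A
  proof -
    have "A \<subseteq> \<Union>\<U>" using compactin_subset_topspace[OF that] cover by auto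
    then show ?thesis using that op unfolding good_def compactin_def by auto
  qed
  have "good (topspace ?E)"
  proof (rule ccontr)
    assume bad_top: "\<not> good (topspace ?E)"
    obtain v0 and lv :: "'v \<Rightarrow> nat" where v0: "v0 \<in> verts G" "lv v0 = 0"
      and zero: "\<And>v. \<lbrakk>v \<in> verts G; lv v = 0\<rbrakk> \<Longrightarrow> v = v0"
      and pred: "\<And>v k. \<lbrakk>v \<in> verts G; lv v = Suc k\<rbrakk> \<Longrightarrow> \<exists>u. adjacent G u v \<and> lv u = k"
      and fin: "\<And>m. finite {v \<in> verts G. lv v \<le> m}"
      by (rule level_function) blast
    define B where "B m = {v \<in> verts G. lv v \<le> m}" for m
    have B: "finite (B m)" "B m \<subseteq> verts G" for m using fin by (auto simp: B_def)
    \<comment> \<open>One step away from the root; \<open>T\<^sup>*\<^sup>* x y\<close> means that a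
      combinatorial geodesic from \<open>v0\<close> to \<open>y\<close> passes through
      \<open>x\<close>.\<close>
    define T where "T x y \<longleftrightarrow> adjacent G x y \<and> lv y = Suc (lv x)" for x y
    have T_v0: "T\<^sup>*\<^sup>* v0 y" if "y \<in> verts G" for y
      using that
    proof (induction "lv y" arbitrary: y)
      case 0
      then show ?case using zero[of y] by simp
    next
      case (Suc k)
      then obtain u where u: "adjacent G u y" "lv u = k" using pred[of y k] by auto
      then have "T\<^sup>*\<^sup>* v0 u" using Suc.hyps(1)[of u] adjacent_verts[OF u(1)] by simp
      moreover have "T u y" using u Suc.hyps(2) by (simp add: T_def)
      ultimately show ?case by (rule rtranclp.rtrancl_into_rtrancl)
    qed
    \<comment> \<open>Walking back from \<open>y\<close> to \<open>x\<close>, levels never drop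
      below \<open>lv x\<close>, so the walk avoids the ball \<open>B m\<close> and stays in the
      component of \<open>y\<close>.\<close>
    have T_component: "Vertex x \<in> C"
      if "T\<^sup>*\<^sup>* x y" "Vertex y \<in> C" "C \<in> components_minus G (B m)" "m < lv x" for x y C m
      using that(1,4)
    proof (induction rule: converse_rtranclp_induct)
      case base
      show ?case by (rule that(2))
    next
      case (step x z)
      then have "Vertex z \<in> C" by (simp add: T_def)
      moreover have "adjacent G z x" using step.hyps(1) adjacent_sym by (simp add: T_def)
      ultimately show ?case
        using step.prems component_adjacent[OF that(3), of z x] by (simp add: B_def)
    qed
    define bad where "bad m C \<longleftrightarrow> C \<in> components_minus G (B m) \<and> \<not> good (end_nbhd G C)" for m C
    have good_edge: "good (end_nbhd G C)"
      if C: "C \<subseteq> Inner e ` {left G e<..<right G e}" and e: "e \<in> edges G" for e C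
    proof (rule good_mono[OF good_compact])
      show "compactin ?E (Inl ` edge_point G e ` {left G e..right G e})"
        by (rule image_compactin[OF image_compactin[OF _ continuous_edge_point[OF e]] continuous_Inl])
          (simp add: compactin_subtopology)
      show "end_nbhd G C \<subseteq> Inl ` edge_point G e ` {left G e..right G e}"
      proof
        fix z assume z: "z \<in> end_nbhd G C"
        show "z \<in> Inl ` edge_point G e ` {left G e..right G e}"
        proof (cases z)
          case (Inl x)
          then have "x \<in> C" using z by simp
          then obtain t where "x = Inner e t" "left G e < t" "t < right G e" using C by auto
          then show ?thesis unfolding Inl by (intro imageI) (auto intro!: image_eqI[of _ _ t])
        next
          case (Inr \<omega>)
          then obtain r :: "nat \<Rightarrow> 'v" where "\<forall>n. Vertex (r n) \<in> C" using z by (auto simp: end_nbhd_def)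
          then have "Vertex (r 0) \<in> C" by blast
          then show ?thesis using C by auto
        qed
      qed
    qed
    \<comment> \<open>The invariant of Koenig's argument: however large the ball, some descendant of
      \<open>x\<close> lies in a component beyond it that is not finitely covered.\<close>
    define P where "P x \<longleftrightarrow> x \<in> verts G \<and> (\<forall>m. \<exists>C y. bad m C \<and> Vertex y \<in> C \<and> T\<^sup>*\<^sup>* x y)" for x
    have P_v0: "P v0"
      unfolding P_def
    proof (intro conjI allI v0)
      fix m
      show "\<exists>C y. bad m C \<and> Vertex y \<in> C \<and> T\<^sup>*\<^sup>* v0 y"
      proof (rule ccontr)
        assume none: "\<not> ?thesis"
        have good_C: "good (end_nbhd G C)" if C: "C \<in> components_minus G (B m)" for C
          using C
        proof (cases rule: component_vertex_or_edge)
          case (1 v)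
          then show ?thesis using none C T_v0[of v] unfolding bad_def by blast
        next
          case (2 e)
          then show ?thesis using good_edge by blast
        qed
        have "topspace ?E \<subseteq> \<Union>((\<lambda>v. {Inl (Vertex v)}) ` B m \<union> end_nbhd G ` components_minus G (B m))"
        proof
          fix z assume z: "z \<in> topspace ?E"
          show "z \<in> \<Union>((\<lambda>v. {Inl (Vertex v)}) ` B m \<union> end_nbhd G ` components_minus G (B m))"
          proof (cases z)
            case (Inl x)
            then have x: "x \<in> points G" using z by (auto simp: topspace_end_compactification)
            show ?thesis
            proof (cases "x \<in> Vertex ` B m")
              case False
              then obtain C where "C \<in> components_minus G (B m)" "x \<in> C"
                using component_exists x by metis
              then show ?thesis using Inl by auto
            qed (use Inl in auto)
          next
            case (Inr \<omega>)
            then have "\<omega> \<in> ends G" using z by (auto simp: topspace_end_compactification)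
            then obtain C where "C \<in> components_minus G (B m)" "Inr \<omega> \<in> end_nbhd G C"
              using B by (rule end_component)
            then show ?thesis unfolding Inr by (intro UnionI[of "end_nbhd G C"] UnI2 imageI)
          qed
        qed
        moreover have "good (\<Union>((\<lambda>v. {Inl (Vertex v)}) ` B m \<union> end_nbhd G ` components_minus G (B m)))"
        proof (rule good_Union)
          show "finite ((\<lambda>v. {Inl (Vertex v)}) ` B m \<union> end_nbhd G ` components_minus G (B m))"
            using B finite_components by auto
          fix A assume "A \<in> (\<lambda>v. {Inl (Vertex v)}) ` B m \<union> end_nbhd G ` components_minus G (B m)"
          then show "good A"
          proof
            assume "A \<in> (\<lambda>v. {Inl (Vertex v)}) ` B m"
            then obtain v where v: "v \<in> B m" "A = {Inl (Vertex v)}" by auto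
            then have "Inl (Vertex v) \<in> topspace ?E"
              using B(2)[of m] by (simp add: topspace_end_compactification subset_iff)
            then obtain U where "U \<in> \<U>" "Inl (Vertex v) \<in> U" using cover by (meson UnionE subsetD)
            then show ?thesis using good_single[of A U] v(2) by simp
          qed (use good_C in auto)
        qed
        ultimately have "good (topspace ?E)" by (rule good_mono[rotated])
        with bad_top show False by contradiction
      qed
    qed
    \<comment> \<open>Shrinking the ball enlarges the component, which then is still not finitely
      covered. A vertex that fails the condition in \<open>P\<close> at one radius therefore fails
      it at every larger one.\<close>
    have bad_antimono: "\<exists>C'. bad m C' \<and> Vertex y \<in> C'"
      if C: "bad m' C" "Vertex y \<in> C" and m: "m \<le> m'" for m m' C y
    proof -
      have C': "C \<in> components_minus G (B m')" using C by (simp add: bad_def)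
      have BB: "B m \<subseteq> B m'" using m by (auto simp: B_def)
      have "Vertex y \<in> points G" "Vertex y \<notin> Vertex ` B m"
        using component_subset[OF C'] C(2) BB by auto
      then obtain D where D: "D \<in> components_minus G (B m)" "Vertex y \<in> D" by (rule component_exists)
      have "C \<subseteq> D" by (rule component_mono[OF C' D(1) BB C(2) D(2)])
      then have "\<not> good (end_nbhd G D)" using C(1) good_mono end_nbhd_mono by (auto simp: bad_def)
      then show ?thesis using D by (auto simp: bad_def)
    qed
    have P_step: "\<exists>z. P z \<and> T x z" if x: "P x" for x
    proof (rule ccontr)
      assume none: "\<not> ?thesis"
      let ?Z = "{z. T x z}"
      have xv: "x \<in> verts G" using x by (simp add: P_def)
      have Z: "finite ?Z" using finite_subset[OF _ finite_neighbours[OF xv]] by (auto simp: T_def)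
      have "\<forall>z\<in>?Z. \<exists>m. \<not> (\<exists>C y. bad m C \<and> Vertex y \<in> C \<and> T\<^sup>*\<^sup>* z y)"
      proof
        fix z assume "z \<in> ?Z"
        then have "T x z" "z \<in> verts G" using adjacent_verts by (auto simp: T_def)
        then show "\<exists>m. \<not> (\<exists>C y. bad m C \<and> Vertex y \<in> C \<and> T\<^sup>*\<^sup>* z y)"
          using none unfolding P_def by blast
      qed
      then obtain k where k: "\<And>z. z \<in> ?Z \<Longrightarrow> \<not> (\<exists>C y. bad (k z) C \<and> Vertex y \<in> C \<and> T\<^sup>*\<^sup>* z y)"
        by (auto simp: bchoice_iff)
      \<comment> \<open>This radius exceeds one failing radius for each of the finitely many
        successors of \<open>x\<close>. Including \<open>lv x\<close> forces the descendant
        \<open>y\<close> beyond \<open>B m\<close> to differ from \<open>x\<close>, so that it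
        descends from some successor.\<close>
      define m where "m = Max (insert (lv x) (k ` ?Z))"
      have km: "k z \<le> m" if "z \<in> ?Z" for z unfolding m_def using Z that by (intro Max_ge) auto
      have lvm: "lv x \<le> m" unfolding m_def using Z by (intro Max_ge) auto
      obtain C y where C: "bad m C" "Vertex y \<in> C" "T\<^sup>*\<^sup>* x y"
        using x unfolding P_def by blast
      have "C \<in> components_minus G (B m)" using C by (simp add: bad_def)
      then have "y \<notin> B m" "y \<in> verts G" using component_subset C(2) by fastforce+
      then have "x \<noteq> y" using lvm by (auto simp: B_def)
      with C(3) obtain z where z: "T x z" "T\<^sup>*\<^sup>* z y" by (auto elim: converse_rtranclpE)
      then have "z \<in> ?Z" by simp
      then show False using bad_antimono[OF C(1,2) km] k z(2) by blast
    qed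
    obtain r where r0: "r 0 = v0" and r: "\<And>n. P (r n) \<and> T (r n) (r (Suc n))"
    proof -
      have "\<exists>r. \<forall>n. (P (r n) \<and> (n = 0 \<longrightarrow> r n = v0)) \<and> T (r n) (r (Suc n))"
        by (rule dependent_nat_choice) (use P_v0 P_step in auto)
      then show thesis using that by blast
    qed
    have lv_r: "lv (r n) = n" for n
      by (induction n) (use r0 v0 r in \<open>auto simp: T_def\<close>)
    have ray: "ray G r"
      unfolding ray_def
    proof (intro conjI allI)
      show "inj r" by (metis injI lv_r)
      show "range r \<subseteq> verts G" using r by (auto simp: P_def)
      show "adjacent G (r n) (r (Suc n))" for n using r by (simp add: T_def)
    qed
    define \<omega> where "\<omega> = end_equiv G `` {r}"
    have \<omega>: "\<omega> \<in> ends G" "r \<in> \<omega>" using ends_class[OF ray] by (auto simp: \<omega>_def)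
    then have "Inr \<omega> \<in> topspace ?E" by (simp add: topspace_end_compactification)
    then obtain U where U: "U \<in> \<U>" "Inr \<omega> \<in> U" using cover by blast
    obtain C S where C: "C \<in> components_minus G S" "finite S" "S \<subseteq> verts G"
      "Inr \<omega> \<in> end_nbhd G C" "end_nbhd G C \<subseteq> U"
      using end_nbhd_basis[OF op[OF U(1)] U(2)] by metis
    define m where "m = Max (insert 0 (lv ` S))"
    have "lv v \<le> m" if "v \<in> S" for v unfolding m_def using that C(2) by (intro Max_ge) auto
    then have S: "S \<subseteq> B m" using C(3) by (auto simp: B_def)
    have "has_tail_in r C" by (rule Inr_end_nbhd_all[OF C(4,1,2,3) \<omega>(2)])
    then obtain N where N: "\<And>n. N \<le> n \<Longrightarrow> Vertex (r n) \<in> C" by (auto simp: has_tail_in_def)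
    \<comment> \<open>From \<open>N\<close> on the ray lies in \<open>C\<close>, and a level above
      \<open>m\<close> is what \<open>T_component\<close> requires. A bad component \<open>D\<close>
      beyond \<open>B m\<close> then contains \<open>r n\<close>, hence lies in \<open>C\<close> and
      is covered by the single set \<open>U\<close>.\<close>
    define n where "n = max N (Suc m)"
    have n: "Vertex (r n) \<in> C" "m < lv (r n)" using N[of n] by (auto simp: n_def lv_r)
    obtain D y where D: "bad m D" "Vertex y \<in> D" "T\<^sup>*\<^sup>* (r n) y"
      using r[of n] unfolding P_def by blast
    have D': "D \<in> components_minus G (B m)" using D by (simp add: bad_def)
    have "Vertex (r n) \<in> D" by (rule T_component[OF D(3,2) D' n(2)])
    then have "D \<subseteq> C" by (rule component_mono[OF D' C(1) S _ n(1)])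
    then have "end_nbhd G D \<subseteq> U" using end_nbhd_mono C(5) by blast
    then show False using good_single[OF _ U(1)] D(1) by (auto simp: bad_def)
  qed
  then show "\<exists>\<F>. finite \<F> \<and> \<F> \<subseteq> \<U> \<and> topspace ?E \<subseteq> \<Union>\<F>" by (simp add: good_def)
qed simp

subsection \<open>The path metric induces the topology of the 1-complex\<close>

lemma gdist_edge_le:
  assumes "e \<in> edges G" "s \<in> {left G e..right G e}" "t \<in> {left G e..right G e}"
  shows "gdist G (edge_point G e s) (edge_point G e t) \<le> \<bar>t - s\<bar>"
proof -
  have "is_path G (edge_point G e s) [(e, s, t)] (edge_point G e t)"
    using assms edge_point_in by simp
  from gdist_le[OF this] show ?thesis by (simp add: path_length_def)
qed

lemma openin_complexD:
  assumes U: "openin (complex_topology G) U" and e: "e \<in> edges G"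
    and t: "t \<in> {left G e..right G e}" "edge_point G e t \<in> U"
  obtains d where "0 < d" "\<And>s. \<lbrakk>s \<in> {left G e..right G e}; \<bar>s - t\<bar> < d\<rbrakk> \<Longrightarrow> edge_point G e s \<in> U"
proof -
  have "openin (top_of_set {left G e..right G e}) {s \<in> {left G e..right G e}. edge_point G e s \<in> U}"
    using U e by (simp add: openin_complex_topology)
  then have "\<forall>x\<in>{s \<in> {left G e..right G e}. edge_point G e s \<in> U}. \<exists>d>0. \<forall>s\<in>{left G e..right G e}.
      dist s x < d \<longrightarrow> s \<in> {s \<in> {left G e..right G e}. edge_point G e s \<in> U}"
    unfolding openin_euclidean_subtopology_iff by (rule conjunct2)
  then have "\<exists>d>0. \<forall>s\<in>{left G e..right G e}.
      dist s t < d \<longrightarrow> s \<in> {s \<in> {left G e..right G e}. edge_point G e s \<in> U}"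
    by (rule bspec) (use t in simp)
  then obtain d where d: "0 < d" "\<forall>s\<in>{left G e..right G e}. dist s t < d \<longrightarrow> edge_point G e s \<in> U"
    by auto
  show thesis by (rule that[OF d(1)]) (use d(2) in \<open>simp add: dist_real_def\<close>)
qed

text \<open>A tent function of height \<open>d\<close> around \<open>t0\<close> is 1-Lipschitz along
  every edge, hence with respect to \<open>gdist\<close>, and vanishes outside \<open>U\<close>.
  Points outside \<open>U\<close> are therefore at distance at least \<open>d\<close>.\<close>

lemma Inner_gball:
  assumes U: "openin (complex_topology G) U" and x: "Inner e0 t0 \<in> U"
  obtains d where "0 < d" "\<And>y. \<lbrakk>y \<in> points G; gdist G (Inner e0 t0) y < d\<rbrakk> \<Longrightarrow> y \<in> U"
proof -
  have xp: "Inner e0 t0 \<in> points G" using x openin_subset[OF U] by auto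
  then have e: "e0 \<in> edges G" "left G e0 < t0" "t0 < right G e0" by auto
  obtain d0 where d0: "0 < d0"
    "\<And>s. \<lbrakk>s \<in> {left G e0..right G e0}; \<bar>s - t0\<bar> < d0\<rbrakk> \<Longrightarrow> edge_point G e0 s \<in> U"
    by (rule openin_complexD[OF U e(1), of t0]) (use e x in auto)
  define d where "d = min d0 (min (t0 - left G e0) (right G e0 - t0))"
  have d: "0 < d" using e d0 by (auto simp: d_def)
  define f :: "('v, 'e) gpoint \<Rightarrow> real" where
    "f z = (case z of Vertex v \<Rightarrow> 0 | Inner e t \<Rightarrow> if e = e0 then max 0 (d - \<bar>t - t0\<bar>) else 0)" for z
  have fe: "f (edge_point G e t) = (if e = e0 then max 0 (d - \<bar>t - t0\<bar>) else 0)" for e t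
    using e by (auto simp: f_def edge_point_def d_def)
  have far: "d \<le> gdist G (Inner e0 t0) y" if y: "y \<in> points G" "y \<notin> U" for y
  proof -
    have "\<bar>f y - f (Inner e0 t0)\<bar> \<le> gdist G (Inner e0 t0) y"
      by (rule gdist_ge_lipschitz) (use xp y in \<open>auto simp: fe\<close>)
    moreover have "f (Inner e0 t0) = d" using d by (simp add: f_def)
    moreover have "f y = 0"
    proof (cases y)
      case (Inner e t)
      have "\<not> \<bar>t - t0\<bar> < d" if "e = e0"
        using d0(2)[of t] y Inner that by (auto simp: d_def)
      then show ?thesis by (auto simp: f_def Inner)
    qed (simp add: f_def)
    ultimately show ?thesis by linarith
  qed
  show thesis by (rule that[OF d]) (meson far not_less)
qed

text \<open>The tent function now lives on the star of \<open>u\<close>. Local finiteness makes the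
  minimum of the admissible radii over the incident edges positive.\<close>

lemma Vertex_gball:
  assumes U: "openin (complex_topology G) U" and x: "Vertex u \<in> U"
  obtains d where "0 < d" "\<And>y. \<lbrakk>y \<in> points G; gdist G (Vertex u) y < d\<rbrakk> \<Longrightarrow> y \<in> U"
proof -
  have u: "u \<in> verts G" using x openin_subset[OF U] by auto
  let ?T = "{e \<in> edges G. src G e = u \<or> tgt G e = u}"
  \<comment> \<open>The bound by the edge length makes the tent vanish at the far end of an edge.
    Both ends are treated separately because a loop meets \<open>u\<close> at both.\<close>
  define ok where "ok e d \<longleftrightarrow> 0 < d \<and> d \<le> right G e - left G e \<and>
      (src G e = u \<longrightarrow> (\<forall>s\<in>{left G e..right G e}. s - left G e < d \<longrightarrow> edge_point G e s \<in> U)) \<and>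
      (tgt G e = u \<longrightarrow> (\<forall>s\<in>{left G e..right G e}. right G e - s < d \<longrightarrow> edge_point G e s \<in> U))" for e d
  have "\<exists>d. ok e d"
    if "e \<in> ?T" for e
  proof -
    have e: "e \<in> edges G" and lr: "left G e < right G e" using that left_less_right by auto
    have l: "\<exists>d>0. src G e = u \<longrightarrow> (\<forall>s\<in>{left G e..right G e}. \<bar>s - left G e\<bar> < d \<longrightarrow> edge_point G e s \<in> U)"
    proof (cases "src G e = u")
      case True
      obtain d where "0 < d" "\<And>s. \<lbrakk>s \<in> {left G e..right G e}; \<bar>s - left G e\<bar> < d\<rbrakk> \<Longrightarrow> edge_point G e s \<in> U"
        by (rule openin_complexD[OF U e, of "left G e"]) (use lr x True in auto)
      then show ?thesis by blast
    qed (auto intro: exI[of _ 1])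
    have r: "\<exists>d>0. tgt G e = u \<longrightarrow> (\<forall>s\<in>{left G e..right G e}. \<bar>s - right G e\<bar> < d \<longrightarrow> edge_point G e s \<in> U)"
    proof (cases "tgt G e = u")
      case True
      obtain d where "0 < d" "\<And>s. \<lbrakk>s \<in> {left G e..right G e}; \<bar>s - right G e\<bar> < d\<rbrakk> \<Longrightarrow> edge_point G e s \<in> U"
        by (rule openin_complexD[OF U e, of "right G e"]) (use lr x e True in auto)
      then show ?thesis by blast
    qed (auto intro: exI[of _ 1])
    from l obtain d1 where "0 < d1"
      "src G e = u \<longrightarrow> (\<forall>s\<in>{left G e..right G e}. \<bar>s - left G e\<bar> < d1 \<longrightarrow> edge_point G e s \<in> U)" by blast
    moreover from r obtain d2 where "0 < d2"
      "tgt G e = u \<longrightarrow> (\<forall>s\<in>{left G e..right G e}. \<bar>s - right G e\<bar> < d2 \<longrightarrow> edge_point G e s \<in> U)" by blast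
    ultimately show ?thesis
      unfolding ok_def using lr by (intro exI[of _ "min (right G e - left G e) (min d1 d2)"]) auto
  qed
  then have "\<exists>k. \<forall>e\<in>?T. ok e (k e)" by (intro bchoice) blast
  then obtain k where ok: "\<And>e. e \<in> ?T \<Longrightarrow> ok e (k e)" by blast
  have k: "0 < k e \<and> k e \<le> right G e - left G e \<and>
      (src G e = u \<longrightarrow> (\<forall>s\<in>{left G e..right G e}. s - left G e < k e \<longrightarrow> edge_point G e s \<in> U)) \<and>
      (tgt G e = u \<longrightarrow> (\<forall>s\<in>{left G e..right G e}. right G e - s < k e \<longrightarrow> edge_point G e s \<in> U))"
    if "e \<in> ?T" for e
    using ok[OF that] unfolding ok_def .
  define d where "d = Min (insert 1 (k ` ?T))"
  have fin: "finite (insert 1 (k ` ?T))" using locally_finite[OF u] by auto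
  have d: "0 < d" unfolding d_def using k by (subst Min_gr_iff[OF fin]) auto
  have dk: "d \<le> k e" if "e \<in> ?T" for e unfolding d_def using fin that by (intro Min_le) auto
  have d_le: "d \<le> right G e - left G e" if "e \<in> edges G" "src G e = u \<or> tgt G e = u" for e
    using dk[of e] k[of e] that by auto
  define g where "g e t = max 0 (max (if src G e = u then d - (t - left G e) else 0)
    (if tgt G e = u then d - (right G e - t) else 0))" for e t
  define f :: "('v, 'e) gpoint \<Rightarrow> real" where
    "f z = (case z of Vertex w \<Rightarrow> if w = u then d else 0 | Inner e t \<Rightarrow> g e t)" for z
  have fe: "f (edge_point G e t) = g e t" if e: "e \<in> edges G" "t \<in> {left G e..right G e}" for e t
    using e(1) d_le[OF e(1)] left_less_right[OF e(1)] d
    by (cases rule: edge_param_cases[OF e]) (auto simp: f_def g_def)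
  have max_lipschitz: "\<bar>max a b - max c d\<bar> \<le> k" if "\<bar>a - c\<bar> \<le> k" "\<bar>b - d\<bar> \<le> k"
    for a b c d k :: real
    using that by linarith
  have g: "\<bar>g e t - g e s\<bar> \<le> \<bar>t - s\<bar>" for e s t
    unfolding g_def by (intro max_lipschitz) (simp_all add: abs_minus_commute)
  have far: "d \<le> gdist G (Vertex u) y" if y: "y \<in> points G" "y \<notin> U" for y
  proof -
    have "\<bar>f y - f (Vertex u)\<bar> \<le> gdist G (Vertex u) y"
      by (rule gdist_ge_lipschitz) (use u y g in \<open>simp_all add: fe\<close>)
    moreover have "f (Vertex u) = d" by (simp add: f_def)
    moreover have "f y = 0"
    proof (cases y)
      case (Vertex w)
      then show ?thesis using y x by (auto simp: f_def)
    next
      case (Inner e t)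
      then have e: "e \<in> edges G" "left G e < t" "t < right G e" using y by auto
      have "\<not> t - left G e < d" if "src G e = u"
      proof
        assume "t - left G e < d"
        then have "t - left G e < k e" "t \<in> {left G e..right G e}" using dk[of e] e that by auto
        then have "edge_point G e t \<in> U" using k[of e] e that by blast
        then show False using y Inner e by simp
      qed
      moreover have "\<not> right G e - t < d" if "tgt G e = u"
      proof
        assume "right G e - t < d"
        then have "right G e - t < k e" "t \<in> {left G e..right G e}" using dk[of e] e that by auto
        then have "edge_point G e t \<in> U" using k[of e] e that by blast
        then show False using y Inner e by simp
      qed
      ultimately show ?thesis by (auto simp: f_def g_def Inner)
    qed
    ultimately show ?thesis by linarith
  qed
  show thesis by (rule that[OF d]) (meson far not_less)
qed

text \<open>This is the half of the comparison of topologies that could fail without local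
  finiteness; the other half is \<open>continuous_embed\<close>.\<close>

lemma complex_gball:
  assumes U: "openin (complex_topology G) U" and x: "x \<in> U"
  obtains d where "0 < d" "\<And>y. \<lbrakk>y \<in> points G; gdist G x y < d\<rbrakk> \<Longrightarrow> y \<in> U"
proof (cases x)
  case (Vertex u)
  then show thesis using Vertex_gball[OF U] x that by metis
next
  case (Inner e t)
  then show thesis using Inner_gball[OF U] x that by metis
qed

end

locale graph_completion = metric_graph G for G :: "('v, 'e) mgraph" (structure) +
  fixes \<iota> :: "('v, 'e) gpoint \<Rightarrow> 'c" and M :: "'c metric"
  assumes completion: "is_completion (graph_metric G) \<iota> M"
begin

subsection \<open>The graph in its completion\<close>

lemma embed_in: "x \<in> points G \<Longrightarrow> \<iota> x \<in> mspace M"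
  using completion by (auto simp: is_completion_def mspace_graph_metric)

lemma embed_dist: "\<lbrakk>x \<in> points G; y \<in> points G\<rbrakk> \<Longrightarrow> mdist M (\<iota> x) (\<iota> y) = gdist G x y"
  using completion by (simp add: is_completion_def mspace_graph_metric mdist_graph_metric)

lemma embed_dense: "mtopology_of M closure_of (\<iota> ` points G) = mspace M"
  using completion by (simp add: is_completion_def mspace_graph_metric)

lemma inj_on_embed: "inj_on \<iota> (points G)"
proof (rule inj_onI, rule ccontr)
  fix x y assume xy: "x \<in> points G" "y \<in> points G" "\<iota> x = \<iota> y" "x \<noteq> y"
  then have "mdist M (\<iota> x) (\<iota> y) = 0" using embed_in by simp
  then show False using embed_dist[OF xy(1,2)] gdist_pos[OF xy(1,2,4)] by simp
qed

text \<open>Openness in the 1-complex is tested edge by edge, and along an edge the embedding is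
  1-Lipschitz by \<open>gdist_edge_le\<close>.\<close>

lemma continuous_embed: "continuous_map (complex_topology G) (mtopology_of M) \<iota>"
  unfolding continuous_map_def
proof (intro conjI allI impI)
  fix U assume U: "openin (mtopology_of M) U"
  show "openin (complex_topology G) {x \<in> topspace (complex_topology G). \<iota> x \<in> U}"
  proof (unfold openin_complex_topology, intro conjI ballI)
    fix e assume e: "e \<in> edges G"
    let ?I = "{left G e..right G e}"
    let ?A = "{t \<in> ?I. edge_point G e t \<in> {x \<in> topspace (complex_topology G). \<iota> x \<in> U}}"
    show "openin (top_of_set ?I) ?A"
      unfolding openin_euclidean_subtopology_iff
    proof (intro conjI ballI)
      fix t assume t: "t \<in> ?A"
      then obtain r where r: "0 < r" "\<forall>q\<in>mspace M. mdist M (\<iota> (edge_point G e t)) q < r \<longrightarrow> q \<in> U"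
        using U unfolding openin_mtopology_of_iff by blast
      have "s \<in> ?A" if s: "s \<in> ?I" "dist s t < r" for s
      proof -
        have p: "edge_point G e s \<in> points G" "edge_point G e t \<in> points G"
          using edge_point_in[OF e] s t by auto
        have "gdist G (edge_point G e t) (edge_point G e s) < r"
          using gdist_edge_le[OF e, of t s] s t by (simp add: dist_real_def)
        then have "\<iota> (edge_point G e s) \<in> U" using r(2) embed_in p embed_dist by simp
        then show ?thesis using s p by simp
      qed
      then show "\<exists>d>0. \<forall>s\<in>?I. dist s t < d \<longrightarrow> s \<in> ?A" using r(1) by blast
    qed auto
  qed auto
qed (use embed_in in auto)

text \<open>The sum \<open>mdist M (\<iota> x) q + path_length p\<close> bounds the distance from
  \<open>q\<close> along the whole remaining path and does not grow as segments are used up. Each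
  segment is thus a connected subset of \<open>P \<union> Q\<close> and cannot change sides.\<close>

lemma path_stays:
  assumes PQ: "openin (complex_topology G) P" "openin (complex_topology G) Q" "disjnt P Q"
    and q: "q \<in> mspace M"
    and r: "\<And>g. \<lbrakk>g \<in> points G; mdist M (\<iota> g) q < r\<rbrakk> \<Longrightarrow> g \<in> P \<union> Q"
  shows "is_path G x p y \<Longrightarrow> x \<in> P \<Longrightarrow> mdist M (\<iota> x) q + path_length p < r \<Longrightarrow> y \<in> P"
proof (induction p arbitrary: x)
  case (Cons a p)
  obtain e s t where a: "a = (e, s, t)" by (cases a) auto
  have e: "e \<in> edges G" and st: "s \<in> {left G e..right G e}" "t \<in> {left G e..right G e}"
    and x: "x = edge_point G e s" and p: "is_path G (edge_point G e t) p y"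
    using Cons.prems(1) by (auto simp: a)
  have len: "path_length (a # p) = \<bar>t - s\<bar> + path_length p" by (simp add: a path_length_def)
  let ?I = "{min s t..max s t}"
  have I: "?I \<subseteq> {left G e..right G e}" using st by auto
  have near: "mdist M (\<iota> (edge_point G e u)) q \<le> \<bar>u - s\<bar> + mdist M (\<iota> x) q" if "u \<in> ?I" for u
  proof -
    have u: "u \<in> {left G e..right G e}" using that I by blast
    have pts: "edge_point G e u \<in> points G" "x \<in> points G" using edge_point_in e u st x by auto
    have "mdist M (\<iota> (edge_point G e u)) q \<le> mdist M (\<iota> (edge_point G e u)) (\<iota> x) + mdist M (\<iota> x) q"
      using pts embed_in q by (intro mdist_triangle) auto
    also have "mdist M (\<iota> (edge_point G e u)) (\<iota> x) \<le> \<bar>u - s\<bar>"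
      using embed_dist[OF pts] gdist_edge_le[OF e u st(1)] x by (simp add: abs_minus_commute)
    finally show ?thesis by simp
  qed
  have "edge_point G e u \<in> P \<union> Q" if "u \<in> ?I" for u
  proof (rule r)
    show "edge_point G e u \<in> points G" using edge_point_in[OF e] that I by blast
    have "\<bar>u - s\<bar> \<le> \<bar>t - s\<bar>" using that by auto
    then show "mdist M (\<iota> (edge_point G e u)) q < r"
      using near[OF that] Cons.prems(3) path_length_nonneg[of p] len by simp
  qed
  then have sub: "edge_point G e ` ?I \<subseteq> P \<union> Q" by blast
  have con: "connectedin (complex_topology G) (edge_point G e ` ?I)"
    by (rule connectedin_edge_image[OF e I]) simp
  have "edge_point G e ` ?I \<inter> Q = {}"
  proof (rule ccontr)
    assume ne: "edge_point G e ` ?I \<inter> Q \<noteq> {}"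
    have "x \<in> P \<inter> edge_point G e ` ?I" using Cons.prems(2) x by auto
    then have neP: "P \<inter> edge_point G e ` ?I \<noteq> {}" by auto
    have "P \<inter> Q \<inter> edge_point G e ` ?I = {}" using PQ(3) by (auto simp: disjnt_iff)
    then show False
      using connectedinD[OF con PQ(1,2) sub _ neP] ne by (simp add: Int_commute)
  qed
  moreover have "edge_point G e t \<in> edge_point G e ` ?I" by auto
  ultimately have "edge_point G e t \<in> P" using sub by blast
  moreover have "mdist M (\<iota> (edge_point G e t)) q + path_length p < r"
    using near[of t] Cons.prems(3) len by simp
  ultimately show ?case by (rule Cons.IH[OF p])
qed auto

text \<open>Near any point of the completion, points of the graph are joined by short paths in the
  graph, so the trace of a small punctured ball on the graph is not split at its centre.\<close>

lemma not_locally_split: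
  assumes PQ: "openin (complex_topology G) P" "openin (complex_topology G) Q" "disjnt P Q"
    and r: "0 < r" "\<And>g. \<lbrakk>g \<in> points G; mdist M (\<iota> g) q < r\<rbrakk> \<Longrightarrow> g \<in> P \<union> Q"
    and q: "q \<in> mtopology_of M closure_of (\<iota> ` P)" "q \<in> mtopology_of M closure_of (\<iota> ` Q)"
  shows False
proof -
  \<comment> \<open>With \<open>x\<close> and \<open>y\<close> within \<open>r / 3\<close> of
    \<open>q\<close>, a path whose excess length is below
    \<open>r / 3 - mdist M q (\<iota> y)\<close> is shorter than
    \<open>mdist M (\<iota> x) q + r / 3\<close>. Adding \<open>mdist M (\<iota> x) q\<close> once
    more still gives less than \<open>r\<close>, the budget of \<open>path_stays\<close>.\<close>
  have r3: "0 < r / 3" using r by simp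
  have qM: "q \<in> mspace M" using q by (simp add: in_closure_of)
  obtain x where x: "x \<in> P" "mdist M q (\<iota> x) < r / 3"
    using in_closure_mtopology_ofD[OF q(1) r3] by blast
  obtain y where y: "y \<in> Q" "mdist M q (\<iota> y) < r / 3"
    using in_closure_mtopology_ofD[OF q(2) r3] by blast
  have pts: "x \<in> points G" "y \<in> points G" using x y openin_subset PQ by fastforce+
  have "gdist G x y \<le> mdist M (\<iota> x) q + mdist M q (\<iota> y)"
    using mdist_triangle[OF embed_in[OF pts(1)] qM embed_in[OF pts(2)]] embed_dist[OF pts] by simp
  moreover obtain p where p: "is_path G x p y"
    "path_length p < gdist G x y + (r / 3 - mdist M q (\<iota> y))"
    using gdist_approx[OF pts, of "r / 3 - mdist M q (\<iota> y)"] y by auto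
  ultimately have len: "mdist M (\<iota> x) q + path_length p < r"
    using x(2) mdist_commute[of M q "\<iota> x"] by linarith
  have "y \<in> P"
    by (rule path_stays[where P = P and Q = Q and q = q and r = r and x = x and p = p])
      (fact PQ qM r p x len)+
  then show False using y PQ(3) by (auto simp: disjnt_iff)
qed

section \<open>Accumulation of the graph at points of the completion\<close>

text \<open>A relation rather than a limit: compactness supplies some \<open>q\<close> for each
  \<open>z\<close>, and weak connectedness makes it unique.\<close>

definition cluster :: "('v, 'e) gpoint + (nat \<Rightarrow> 'v) set \<Rightarrow> 'c \<Rightarrow> bool" where
  "cluster z q \<longleftrightarrow> q \<in> mspace M \<and> (\<forall>N. openin (end_compactification G) N \<and> z \<in> N \<longrightarrow>
     q \<in> mtopology_of M closure_of (\<iota> ` (Inl -` N)))"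

lemma cluster_in: "cluster z q \<Longrightarrow> q \<in> mspace M"
  unfolding cluster_def by (rule conjunct1)

lemma clusterD:
  "\<lbrakk>cluster z q; openin (end_compactification G) N; z \<in> N\<rbrakk> \<Longrightarrow>
    q \<in> mtopology_of M closure_of (\<iota> ` (Inl -` N))"
  unfolding cluster_def by (elim conjE allE[of _ N] impE) (intro conjI)

lemma cluster_hull:
  assumes "cluster z q" "openin (complex_topology G) P" "z \<in> end_hull P"
  shows "q \<in> mtopology_of M closure_of (\<iota> ` P)"
proof -
  have "Inl -` end_hull P = P" by auto
  then show ?thesis using clusterD[OF assms(1) openin_end_hull[OF assms(2)] assms(3)] by simp
qed

lemma graph_dense_end:
  assumes N: "openin (end_compactification G) N" "z \<in> N"
  shows "Inl -` N \<noteq> ({} :: ('v, 'e) gpoint set)"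
proof (cases z)
  case (Inl x)
  then show ?thesis using N by auto
next
  case (Inr \<omega>)
  then have "Inr \<omega> \<in> N" using N(2) by simp
  then obtain C S where C: "C \<in> components_minus G S" "end_nbhd G C \<subseteq> N"
    by (rule end_nbhd_basis[OF N(1)])
  obtain x where "x \<in> C" using component_nonempty[OF C(1)] by auto
  then have "Inl x \<in> N" by (intro subsetD[OF C(2)]) simp
  then show ?thesis by auto
qed

text \<open>Finite intersection property for the closures of the traces. The closed set
  \<open>K\<close> is a parameter because two choices are used: the whole space gives existence, and
  the complement of an open set gives continuity.\<close>

lemma cluster_exists:
  assumes compact: "compact_space (mtopology_of M)" and K: "closedin (mtopology_of M) K"
    and z: "z \<in> topspace (end_compactification G)"
    and meets: "\<And>N. \<lbrakk>openin (end_compactification G) N; z \<in> N\<rbrakk> \<Longrightarrow>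
      mtopology_of M closure_of (\<iota> ` (Inl -` N)) \<inter> K \<noteq> {}"
  shows "\<exists>q\<in>K. cluster z q"
proof -
  let ?\<N> = "{N. openin (end_compactification G) N \<and> z \<in> N}"
  define c :: "(('v, 'e) gpoint + (nat \<Rightarrow> 'v) set) set \<Rightarrow> 'c set"
    where "c N = mtopology_of M closure_of (\<iota> ` (Inl -` N)) \<inter> K" for N
  have "\<Inter>(c ` ?\<N>) \<noteq> {}"
  proof (rule compact_space_fip[THEN iffD1, OF compact, rule_format], intro conjI ballI allI impI)
    show "closedin (mtopology_of M) A" if "A \<in> c ` ?\<N>" for A
      using that K by (auto simp: c_def)
    fix \<F> assume "finite \<F> \<and> \<F> \<subseteq> c ` ?\<N>"
    then have "\<exists>\<M>\<subseteq>?\<N>. finite \<M> \<and> \<F> = c ` \<M>" by (intro finite_subset_image) auto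
    then obtain \<M> where M: "finite \<M>" "\<M> \<subseteq> ?\<N>" "\<F> = c ` \<M>" by (elim exE conjE)
    \<comment> \<open>Intersecting with the whole space covers the empty family.\<close>
    define N0 where "N0 = topspace (end_compactification G) \<inter> \<Inter>\<M>"
    have "openin (end_compactification G) N0"
      unfolding N0_def by (rule openin_Int_Inter[OF M(1) openin_topspace]) (use M(2) in blast)
    moreover have "z \<in> N0" unfolding N0_def using M(2) z by blast
    ultimately have N0: "openin (end_compactification G) N0" "z \<in> N0" .
    have "c N0 \<subseteq> c N" if "N \<in> \<M>" for N
    proof -
      have "N0 \<subseteq> N" using that by (auto simp: N0_def)
      then show ?thesis unfolding c_def by (intro Int_mono closure_of_mono image_mono vimage_mono order_refl)
    qed
    then have "c N0 \<subseteq> \<Inter>\<F>" unfolding M(3) by (rule INT_greatest)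
    moreover have "c N0 \<noteq> {}" using meets[OF N0] by (simp add: c_def)
    ultimately show "\<Inter>\<F> \<noteq> {}" by auto
  qed
  then obtain q where q: "q \<in> \<Inter>(c ` ?\<N>)" by blast
  have in_c: "q \<in> c N" if "openin (end_compactification G) N" "z \<in> N" for N
    using INT_D[OF q, of N] that by simp
  have "q \<in> K" using in_c[OF openin_topspace z] unfolding c_def by (rule IntD2)
  moreover have "q \<in> mspace M" using closedin_subset[OF K] \<open>q \<in> K\<close> by auto
  moreover have "q \<in> mtopology_of M closure_of (\<iota> ` (Inl -` N))"
    if "openin (end_compactification G) N" "z \<in> N" for N
    using in_c[OF that] unfolding c_def by (rule IntD1)
  ultimately have "cluster z q" unfolding cluster_def by simp
  then show ?thesis using \<open>q \<in> K\<close> by (rule bexI)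
qed

lemma cluster_Inl_unique:
  assumes x: "x \<in> points G" and q: "cluster (Inl x) q"
  shows "q = \<iota> x"
proof (rule ccontr)
  assume ne: "q \<noteq> \<iota> x"
  obtain V O' where O: "openin (mtopology_of M) V" "openin (mtopology_of M) O'"
    "q \<in> V" "\<iota> x \<in> O'" "disjnt V O'"
    using Hausdorff_mtopology_of[of M, unfolded Hausdorff_space_def, rule_format, of q "\<iota> x"]
      cluster_in[OF q] embed_in[OF x] ne by auto
  let ?U = "{y \<in> topspace (complex_topology G). \<iota> y \<in> O'}"
  have U: "openin (complex_topology G) ?U"
    by (rule openin_continuous_map_preimage[OF continuous_embed O(2)])
  have "q \<in> mtopology_of M closure_of (\<iota> ` ?U)"
    by (rule cluster_hull[OF q U]) (use x O in simp)
  moreover have "\<iota> ` ?U \<inter> V = {}" using O(5) by (auto simp: disjnt_iff)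
  ultimately show False using not_in_closure_of[OF O(1,3)] by blast
qed

text \<open>Pull a separation of \<open>p\<close> and \<open>q\<close> back to the graph;
  injectivity of \<open>\<iota>\<close> keeps the cut set finite. By \<open>end_hull_cut\<close>,
  \<open>z\<close> either lies in one of the two hulls, and then the point on the other side is not
  accumulated, or is one of the cut points, where \<open>cluster_Inl_unique\<close> applies.\<close>

lemma cluster_unique:
  assumes wc: "weakly_connected (mtopology_of M) (\<iota> ` points G)"
    and z: "z \<in> topspace (end_compactification G)" and pq: "cluster z p" "cluster z q"
  shows "p = q"
proof (rule ccontr)
  assume ne: "p \<noteq> q"
  have pqM: "p \<in> mspace M" "q \<in> mspace M" using pq cluster_in by auto
  from wc[unfolded weakly_connected_def, THEN bspec, THEN bspec, of p q] pqM ne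
  obtain W U V where W: "finite W" "W \<subseteq> \<iota> ` points G"
    and UV: "openin (mtopology_of M) U" "openin (mtopology_of M) V" "disjnt U V" "p \<in> U" "q \<in> V"
      "mspace M - W = U \<union> V"
    by auto
  define W' P Q where "W' = {x \<in> points G. \<iota> x \<in> W}" and "P = {x \<in> points G. \<iota> x \<in> U}"
    and "Q = {x \<in> points G. \<iota> x \<in> V}"
  note defs = W'_def P_def Q_def
  have PQ: "openin (complex_topology G) P" "openin (complex_topology G) Q"
    using openin_continuous_map_preimage[OF continuous_embed UV(1)]
      openin_continuous_map_preimage[OF continuous_embed UV(2)] by (simp_all add: defs)
  have dis: "disjnt P Q" using UV(3) by (auto simp: disjnt_iff defs)
  have fin: "finite W'"
  proof (rule inj_on_finite)
    show "inj_on \<iota> W'" by (rule inj_on_subset[OF inj_on_embed]) (auto simp: defs)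
    show "\<iota> ` W' \<subseteq> W" by (auto simp: defs)
  qed (rule W)
  have PQ_eq: "P \<union> Q = points G - W'"
  proof (intro equalityI subsetI)
    fix x assume "x \<in> P \<union> Q"
    then have "x \<in> points G" "\<iota> x \<in> U \<union> V" by (auto simp: defs)
    then show "x \<in> points G - W'" unfolding UV(6)[symmetric] by (simp add: defs)
  next
    fix x assume "x \<in> points G - W'"
    then have "x \<in> points G" "\<iota> x \<in> mspace M - W" using embed_in by (auto simp: defs)
    then show "x \<in> P \<union> Q" unfolding UV(6) by (auto simp: defs)
  qed
  have cut: "end_hull P \<union> end_hull Q = topspace (end_compactification G) - Inl ` W'"
    by (rule end_hull_cut[OF PQ dis fin _ PQ_eq]) (auto simp: defs)
  consider "z \<in> end_hull P" | "z \<in> end_hull Q" | x where "x \<in> points G" "z = Inl x"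
  proof (cases "z \<in> Inl ` W'")
    case True
    then show thesis using that(3) by (auto simp: defs)
  next
    case False
    then have "z \<in> end_hull P \<union> end_hull Q" using cut z by simp
    then show thesis using that(1,2) by auto
  qed
  then show False
  proof cases
    case 1
    then have "q \<in> mtopology_of M closure_of (\<iota> ` P)" by (rule cluster_hull[OF pq(2) PQ(1)])
    moreover have "\<iota> ` P \<inter> V = {}" using UV(3) by (auto simp: disjnt_iff defs)
    ultimately show False using not_in_closure_of[OF UV(2,5)] by blast
  next
    case 2
    then have "p \<in> mtopology_of M closure_of (\<iota> ` Q)" by (rule cluster_hull[OF pq(1) PQ(2)])
    moreover have "\<iota> ` Q \<inter> U = {}" using UV(3) by (auto simp: disjnt_iff defs)
    ultimately show False using not_in_closure_of[OF UV(1,4)] by blast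
  next
    case 3
    then have "p = \<iota> x" "q = \<iota> x" using cluster_Inl_unique[OF 3(1)] pq by auto
    with ne show False by simp
  qed
qed

text \<open>If a cut puts \<open>w\<close> into \<open>Q\<close> and \<open>z\<close> on the side of
  \<open>P\<close>, a metric ball around \<open>w\<close> meets the graph only in \<open>Q\<close>,
  so \<open>P\<close> cannot accumulate at \<open>\<iota> w\<close>. This covers the points
  \<open>q\<close> that might be cut points in \<open>cluster_inj\<close>.\<close>

lemma cluster_embed_unique:
  assumes w: "w \<in> points G" and z: "z \<in> topspace (end_compactification G)" "cluster z (\<iota> w)"
  shows "z = Inl w"
proof (rule ccontr)
  assume "z \<noteq> Inl w"
  then have "end_separated z (Inl w)"
    using w z by (intro end_separation) (auto simp: topspace_end_compactification)
  then obtain W P Q where "finite W" "W \<subseteq> points G - range Vertex"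
    and PQ: "openin (complex_topology G) P" "openin (complex_topology G) Q" "disjnt P Q"
    and "P \<union> Q = points G - W" and PQ': "z \<in> end_hull P" "w \<in> Q"
    unfolding end_separated_def Inl_end_hull_iff by (elim exE conjE)
  obtain d where d: "0 < d" "\<And>y. \<lbrakk>y \<in> points G; gdist G w y < d\<rbrakk> \<Longrightarrow> y \<in> Q"
    using complex_gball[OF PQ(2) PQ'(2)] by metis
  obtain y where y: "y \<in> P" "mdist M (\<iota> w) (\<iota> y) < d"
    using in_closure_mtopology_ofD[OF cluster_hull[OF z(2) PQ(1) PQ'(1)] d(1)] by (metis imageE)
  then have yp: "y \<in> points G" using openin_subset[OF PQ(1)] by auto
  then have "y \<in> Q" using d(2)[OF yp] y(2) embed_dist[OF w yp] by simp
  then show False using y(1) PQ(3) by (auto simp: disjnt_iff)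
qed

lemma cluster_inj:
  assumes z: "z \<in> topspace (end_compactification G)" "z' \<in> topspace (end_compactification G)"
    and q: "cluster z q" "cluster z' q"
  shows "z = z'"
proof (rule ccontr)
  assume ne: "z \<noteq> z'"
  then have "end_separated z z'" by (rule end_separation[OF z])
  then obtain W P Q where W: "finite W" "W \<subseteq> points G - range Vertex"
    and PQ: "openin (complex_topology G) P" "openin (complex_topology G) Q" "disjnt P Q"
    and PQ_eq: "P \<union> Q = points G - W" and hull: "z \<in> end_hull P" "z' \<in> end_hull Q"
    unfolding end_separated_def by (elim exE conjE)
  have "q \<notin> \<iota> ` points G"
    using cluster_embed_unique[OF _ z(1)] cluster_embed_unique[OF _ z(2)] q ne by blast
  then have far: "0 < mdist M (\<iota> w) q" if "w \<in> W" for w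
  proof -
    have w: "w \<in> points G" using that W(2) by blast
    then have "\<iota> w \<noteq> q" using \<open>q \<notin> \<iota> ` points G\<close> by blast
    then have "mdist M (\<iota> w) q \<noteq> 0" using mdist_zero[OF embed_in[OF w] cluster_in[OF q(1)]] by metis
    then show ?thesis using mdist_nonneg[of M "\<iota> w" q] by linarith
  qed
  \<comment> \<open>Since \<open>q\<close> lies outside the graph, it has positive distance from
    each of the finitely many cut points; the entry 1 covers an empty \<open>W\<close>.\<close>
  define r where "r = Min (insert 1 ((\<lambda>w. mdist M (\<iota> w) q) ` W))"
  have fin: "finite (insert 1 ((\<lambda>w. mdist M (\<iota> w) q) ` W))" using W by simp
  have r: "0 < r" unfolding r_def using far by (subst Min_gr_iff[OF fin]) auto
  have rW: "r \<le> mdist M (\<iota> w) q" if "w \<in> W" for w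
    unfolding r_def using that fin by (intro Min_le) auto
  show False
  proof (rule not_locally_split[OF PQ r])
    fix g assume g: "g \<in> points G" "mdist M (\<iota> g) q < r"
    then have "g \<notin> W" using rW[of g] by auto
    then show "g \<in> P \<union> Q" using g PQ_eq by blast
  qed (rule cluster_hull[OF q(1) PQ(1) hull(1)] cluster_hull[OF q(2) PQ(2) hull(2)])+
qed

lemma homeomorphic_if_weakly_connected:
  assumes compact: "compact_space (mtopology_of M)"
    and wc: "weakly_connected (mtopology_of M) (\<iota> ` points G)"
  shows "mtopology_of M homeomorphic_space end_compactification G"
proof -
  let ?E = "end_compactification G" and ?X = "mtopology_of M"
  have ex: "\<exists>q. cluster z q" if z: "z \<in> topspace ?E" for z
  proof -
    have "\<exists>q\<in>mspace M. cluster z q"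
    proof (rule cluster_exists[OF compact _ z])
      show "closedin ?X (mspace M)" using closedin_topspace[of ?X] by simp
      fix N assume N: "openin ?E N" "z \<in> N"
      have "Inl -` N \<subseteq> points G" using openin_subset[OF openin_end_Inl_vimage[OF N(1)]] by simp
      then have "\<iota> ` (Inl -` N) \<subseteq> mspace M" using embed_in by blast
      then have "\<iota> ` (Inl -` N) \<subseteq> ?X closure_of (\<iota> ` (Inl -` N)) \<inter> mspace M"
        using closure_of_subset[of "\<iota> ` (Inl -` N)" ?X] by simp
      then show "?X closure_of (\<iota> ` (Inl -` N)) \<inter> mspace M \<noteq> {}"
        using graph_dense_end[OF N] by blast
    qed
    then show ?thesis by blast
  qed
  define f where "f z = (SOME q. cluster z q)" for z
  have f: "cluster z (f z)" if "z \<in> topspace ?E" for z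
    unfolding f_def using ex[OF that] by (rule someI_ex)
  have f_eq: "f z = q" if "z \<in> topspace ?E" "cluster z q" for z q
    by (rule cluster_unique[OF wc that(1) f[OF that(1)] that(2)])
  have f_Inl: "f (Inl x) = \<iota> x" if "x \<in> points G" for x
    using cluster_Inl_unique[OF that f] that by (simp add: topspace_end_compactification)
  have cont: "continuous_map ?E ?X f"
    unfolding continuous_map_def
  proof (intro conjI allI impI)
    show "f \<in> topspace ?E \<rightarrow> topspace ?X" using f cluster_in by auto
    fix U assume U: "openin ?X U"
    have K: "closedin ?X (mspace M - U)" using closedin_diff[OF closedin_topspace U] by simp
    show "openin ?E {z \<in> topspace ?E. f z \<in> U}"
    proof (subst openin_subopen, intro ballI)
      fix z assume "z \<in> {z \<in> topspace ?E. f z \<in> U}"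
      then have z: "z \<in> topspace ?E" "f z \<in> U" by auto
      \<comment> \<open>The only accumulation point of \<open>z\<close> lies in \<open>U\<close>. By
        \<open>cluster_exists\<close> with the complement of \<open>U\<close>, some neighbourhood
        \<open>N\<close> of \<open>z\<close> has a trace whose closure lies in \<open>U\<close>, and
        this closure contains \<open>f z'\<close> for all \<open>z'\<close> in
        \<open>N\<close>.\<close>
      have "\<not> (\<exists>q\<in>mspace M - U. cluster z q)" using f_eq[OF z(1)] z(2) by auto
      then obtain N where N: "openin ?E N" "z \<in> N"
        "?X closure_of (\<iota> ` (Inl -` N)) \<inter> (mspace M - U) = {}"
        using cluster_exists[OF compact K z(1)] by metis
      have "f z' \<in> U" if "z' \<in> N" for z'
      proof -
        have z': "z' \<in> topspace ?E" using openin_subset[OF N(1)] that by auto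
        show ?thesis
          using clusterD[OF f[OF z'] N(1) that] cluster_in[OF f[OF z']] N(3) by auto
      qed
      then have "N \<subseteq> {z \<in> topspace ?E. f z \<in> U}" using openin_subset[OF N(1)] by auto
      with N show "\<exists>T. openin ?E T \<and> z \<in> T \<and> T \<subseteq> {z \<in> topspace ?E. f z \<in> U}" by blast
    qed
  qed
  have "compactin ?X (f ` topspace ?E)"
    using image_compactin[OF _ cont] compact_end_compactification by (simp add: compact_space_def)
  then have "closedin ?X (f ` topspace ?E)"
    by (rule compactin_imp_closedin[OF Hausdorff_mtopology_of])
  moreover have "\<iota> ` points G \<subseteq> f ` topspace ?E"
  proof
    fix q assume "q \<in> \<iota> ` points G"
    then obtain x where x: "x \<in> points G" "q = f (Inl x)" using f_Inl by auto
    then show "q \<in> f ` topspace ?E" by (simp add: topspace_end_compactification)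
  qed
  ultimately have "mspace M \<subseteq> f ` topspace ?E"
    using closure_of_minimal embed_dense by metis
  moreover have "f ` topspace ?E \<subseteq> mspace M" using f cluster_in by auto
  ultimately have surj: "f ` topspace ?E = topspace ?X" by simp
  have "inj_on f (topspace ?E)"
  proof (rule inj_onI)
    fix z z' assume z: "z \<in> topspace ?E" "z' \<in> topspace ?E" "f z = f z'"
    show "z = z'" by (rule cluster_inj[OF z(1,2) f[OF z(1)]]) (use f[OF z(2)] z(3) in simp)
  qed
  then have "homeomorphic_map ?E ?X f"
    by (intro continuous_imp_homeomorphic_map cont compact_end_compactification Hausdorff_mtopology_of surj)
  then show ?thesis
    by (rule homeomorphic_space_sym[THEN iffD1, OF homeomorphic_map_imp_homeomorphic_space])
qed

text \<open>A homeomorphism need not respect the two copies of the graph, but an inner point of an edge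
  separates its small neighbourhoods, which by \<open>not_locally_split\<close> no point outside the
  graph does.\<close>

lemma homeomorphic_map_Inner:
  assumes h: "homeomorphic_map (end_compactification G) (mtopology_of M) h"
    and w: "Inner e t0 \<in> points G"
  shows "h (Inl (Inner e t0)) \<in> \<iota> ` points G"
proof (rule ccontr)
  let ?E = "end_compactification G" and ?X = "mtopology_of M" and ?w = "Inner e t0"
  let ?q = "h (Inl ?w)" and ?I = "{left G e<..<right G e}"
  assume out: "?q \<notin> \<iota> ` points G"
  have e: "e \<in> edges G" "left G e < t0" "t0 < right G e" using w by auto
  have hom: "h ` topspace ?E = mspace M" using homeomorphic_imp_surjective_map[OF h] by simp
  have inj: "inj_on h (topspace ?E)" by (rule homeomorphic_imp_injective_map[OF h])
  define L :: "real set \<Rightarrow> ('v, 'e) gpoint set" where "L I = Inner e ` (?I \<inter> I)" for I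
  have L: "openin (complex_topology G) (L I)" "L I \<subseteq> points G" if "open I" for I
    using openin_complex_Inner_image[OF e(1) that] e by (auto simp: L_def)
  have hL: "openin ?X (h ` Inl ` L I)" if "open I" for I
  proof -
    have o: "openin ?E (Inl ` L I)" by (rule openin_Inl_image[OF L(1)[OF that]])
    show ?thesis using homeomorphic_map_openness[OF h openin_subset[OF o]] o by simp
  qed
  \<comment> \<open>Two copies of the graph meet here: \<open>P I\<close> consists of the points
    whose copy under \<open>\<iota>\<close> falls into the \<open>h\<close>-image of a piece of the
    edge \<open>e\<close>. The pieces on the two sides of \<open>t0\<close> will play the parts of
    \<open>P\<close> and \<open>Q\<close> in \<open>not_locally_split\<close>.\<close>
  define P where "P I = {x \<in> points G. \<iota> x \<in> h ` Inl ` L I}" for I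
  have P: "openin (complex_topology G) (P I)" if "open I" for I
    using openin_continuous_map_preimage[OF continuous_embed hL[OF that]] by (simp add: P_def)
  have in_top: "Inl x \<in> topspace ?E" if "x \<in> points G" for x
    using that by (simp add: topspace_end_compactification)
  have "P {..<t0} \<inter> P {t0<..} = {}"
  proof (rule ccontr)
    assume "P {..<t0} \<inter> P {t0<..} \<noteq> {}"
    then obtain x where x: "\<iota> x \<in> h ` Inl ` L {..<t0}" "\<iota> x \<in> h ` Inl ` L {t0<..}"
      by (auto simp: P_def)
    from x(1) obtain a where a: "a \<in> L {..<t0}" "\<iota> x = h (Inl a)" by auto
    from x(2) obtain b where b: "b \<in> L {t0<..}" "\<iota> x = h (Inl b)" by auto
    have ab: "a \<in> L {..<t0}" "b \<in> L {t0<..}" "h (Inl a) = h (Inl b)" using a b by auto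
    have "a \<in> points G" by (rule subsetD[OF L(2) ab(1)]) simp
    moreover have "b \<in> points G" by (rule subsetD[OF L(2) ab(2)]) simp
    ultimately have "a = b" using inj_onD[OF inj ab(3)] in_top by simp
    then show False using ab by (auto simp: L_def)
  qed
  then have dis: "disjnt (P {..<t0}) (P {t0<..})" by (simp add: disjnt_def)
  have "?q \<in> h ` Inl ` L UNIV" using e by (auto simp: L_def)
  then obtain r where r: "0 < r" "\<forall>p\<in>mspace M. mdist M ?q p < r \<longrightarrow> p \<in> h ` Inl ` L UNIV"
    using hL[OF open_UNIV] unfolding openin_mtopology_of_iff by auto
  \<comment> \<open>A small ball around the image point lies in the image of the open edge. The only
    value of the edge parameter on neither side is \<open>t0\<close>, and its image is not in the
    graph by assumption.\<close>
  have cover: "g \<in> P {..<t0} \<union> P {t0<..}" if g: "g \<in> points G" "mdist M (\<iota> g) ?q < r" for g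
  proof -
    have "\<iota> g \<in> h ` Inl ` L UNIV"
      using r(2) embed_in[OF g(1)] g(2) mdist_commute[of M] by metis
    then obtain t where t: "t \<in> ?I" "\<iota> g = h (Inl (Inner e t))" by (auto simp: L_def)
    have "t \<noteq> t0"
    proof
      assume "t = t0"
      then have "?q = \<iota> g" using t(2) by simp
      then show False using out g(1) by simp
    qed
    then consider "t < t0" | "t0 < t" by linarith
    then show ?thesis
    proof cases
      case 1
      then have "Inner e t \<in> L {..<t0}" using t by (simp add: L_def)
      then show ?thesis using t(2) g(1) by (auto simp: P_def)
    next
      case 2
      then have "Inner e t \<in> L {t0<..}" using t by (simp add: L_def)
      then show ?thesis using t(2) g(1) by (auto simp: P_def)
    qed
  qed
  \<comment> \<open>Images under \<open>h\<close> of edge points near \<open>t0\<close> approach the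
    image point, but may themselves lie outside the graph. Density of the graph in the open set
    \<open>T \<inter> h\<close> Inl \<open>L I\<close> replaces them by points of
    \<open>P I\<close>.\<close>
  have closure: "?q \<in> ?X closure_of (\<iota> ` P I)"
    if I: "open I" and acc: "\<And>d. 0 < d \<Longrightarrow> \<exists>t\<in>?I \<inter> I. \<bar>t - t0\<bar> < d" for I
    unfolding in_closure_of
  proof (intro conjI allI impI)
    show "?q \<in> topspace ?X" using hom in_top[OF w] by auto
    fix T assume T: "?q \<in> T \<and> openin ?X T"
    have "openin ?E {z \<in> topspace ?E. h z \<in> T}"
      by (rule openin_continuous_map_preimage[OF homeomorphic_imp_continuous_map[OF h] T[THEN conjunct2]])
    then have N: "openin (complex_topology G) (Inl -` {z \<in> topspace ?E. h z \<in> T})"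
      by (rule openin_end_Inl_vimage)
    obtain d where d: "0 < d" "\<And>s. \<lbrakk>s \<in> {left G e..right G e}; \<bar>s - t0\<bar> < d\<rbrakk> \<Longrightarrow>
        edge_point G e s \<in> Inl -` {z \<in> topspace ?E. h z \<in> T}"
      by (rule openin_complexD[OF N e(1), of t0]) (use e T in_top[OF w] in auto)
    obtain t where t: "t \<in> ?I \<inter> I" "\<bar>t - t0\<bar> < d" using acc[OF d(1)] by blast
    then have "h (Inl (Inner e t)) \<in> T" using d(2)[of t] by auto
    moreover have "h (Inl (Inner e t)) \<in> h ` Inl ` L I" using t by (auto simp: L_def)
    ultimately have "T \<inter> h ` Inl ` L I \<noteq> {}" by auto
    moreover have "openin ?X (T \<inter> h ` Inl ` L I)" using T hL[OF I] by auto
    moreover have "?X closure_of (\<iota> ` points G) = topspace ?X" using embed_dense by simp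
    ultimately have "\<iota> ` points G \<inter> (T \<inter> h ` Inl ` L I) \<noteq> {}"
      using dense_intersects_open[THEN iffD1, rule_format] by metis
    then obtain x where "x \<in> points G" "\<iota> x \<in> T" "\<iota> x \<in> h ` Inl ` L I" by auto
    then show "\<exists>y. y \<in> \<iota> ` P I \<and> y \<in> T" by (auto simp: P_def)
  qed
  show False
  proof (rule not_locally_split[OF P P dis r(1) cover])
    show "?q \<in> ?X closure_of (\<iota> ` P {..<t0})"
    proof (rule closure)
      fix d :: real assume "0 < d"
      then show "\<exists>t\<in>?I \<inter> {..<t0}. \<bar>t - t0\<bar> < d"
        using e by (intro bexI[of _ "t0 - min d (t0 - left G e) / 2"]) (auto simp: min_def field_simps)
    qed simp
    show "?q \<in> ?X closure_of (\<iota> ` P {t0<..})"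
    proof (rule closure)
      fix d :: real assume "0 < d"
      then show "\<exists>t\<in>?I \<inter> {t0<..}. \<bar>t - t0\<bar> < d"
        using e by (intro bexI[of _ "t0 + min d (right G e - t0) / 2"]) (auto simp: min_def field_simps)
    qed simp
  qed simp_all
qed

lemma weakly_connected_if_homeomorphic:
  assumes "mtopology_of M homeomorphic_space end_compactification G"
  shows "weakly_connected (mtopology_of M) (\<iota> ` points G)"
proof -
  let ?E = "end_compactification G" and ?X = "mtopology_of M"
  obtain h where h: "homeomorphic_map ?E ?X h"
    using homeomorphic_space_sym[THEN iffD1, OF assms] unfolding homeomorphic_space by blast
  have surj: "h ` topspace ?E = topspace ?X" by (rule homeomorphic_imp_surjective_map[OF h])
  have inj: "inj_on h (topspace ?E)" by (rule homeomorphic_imp_injective_map[OF h])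
  show ?thesis
    unfolding weakly_connected_def
  proof (intro ballI impI)
    fix x y assume xy: "x \<in> topspace ?X" "y \<in> topspace ?X" "x \<noteq> y"
    then have "x \<in> h ` topspace ?E" "y \<in> h ` topspace ?E" unfolding surj by auto
    then obtain z z' where z: "z \<in> topspace ?E" "z' \<in> topspace ?E" "x = h z" "y = h z'" by blast
    then have "end_separated z z'" using xy by (intro end_separation) auto
    then obtain W P Q where W: "finite W" "W \<subseteq> points G - range Vertex"
      and PQ: "openin (complex_topology G) P" "openin (complex_topology G) Q" "disjnt P Q"
      and PQ_eq: "P \<union> Q = points G - W" and hull: "z \<in> end_hull P" "z' \<in> end_hull Q"
      unfolding end_separated_def by (elim exE conjE)
    have cut: "end_hull P \<union> end_hull Q = topspace ?E - Inl ` W"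
      using W by (intro end_hull_cut PQ PQ_eq) auto
    have sub: "end_hull P \<subseteq> topspace ?E" "end_hull Q \<subseteq> topspace ?E" "Inl ` W \<subseteq> topspace ?E"
      using openin_subset[OF openin_end_hull] PQ W by (auto simp: topspace_end_compactification)
    show "\<exists>W U V. finite W \<and> W \<subseteq> \<iota> ` points G \<and> openin ?X U \<and> openin ?X V \<and> disjnt U V \<and>
        x \<in> U \<and> y \<in> V \<and> topspace ?X - W = U \<union> V"
    proof (intro exI conjI)
      show "finite (h ` Inl ` W)" using W by simp
      \<comment> \<open>Here the choice of cut points without vertices pays off.\<close>
      show "h ` Inl ` W \<subseteq> \<iota> ` points G"
      proof clarify
        fix w assume w: "w \<in> W"
        then obtain e t where "w = Inner e t" using W(2) by (cases w) auto
        then show "h (Inl w) \<in> \<iota> ` points G" using homeomorphic_map_Inner[OF h] w W(2) by blast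
      qed
      show "openin ?X (h ` end_hull P)" "openin ?X (h ` end_hull Q)"
        unfolding homeomorphic_map_openness[OF h sub(1)] homeomorphic_map_openness[OF h sub(2)]
        by (intro openin_end_hull PQ)+
      show "disjnt (h ` end_hull P) (h ` end_hull Q)"
        unfolding disjnt_def using inj_on_image_Int[OF inj sub(1,2)] disjnt_end_hull[OF PQ(3)]
        by (simp add: disjnt_def)
      show "x \<in> h ` end_hull P" "y \<in> h ` end_hull Q" using z hull by auto
      have "topspace ?X - h ` Inl ` W = h ` (topspace ?E - Inl ` W)"
        unfolding surj[symmetric] by (rule inj_on_image_set_diff[OF inj _ sub(3), symmetric]) simp
      then show "topspace ?X - h ` Inl ` W = h ` end_hull P \<union> h ` end_hull Q"
        by (simp add: cut[symmetric] image_Un)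
    qed
  qed
qed

end

theorem corollary2p4:
  fixes G :: "('v, 'e) mgraph"
    and \<iota> :: "('v, 'e) gpoint \<Rightarrow> 'c"
    and M :: "'c metric"
  assumes "metric_graph G"
    and "is_completion (graph_metric G) \<iota> M"
  shows "mtopology_of M homeomorphic_space end_compactification G \<longleftrightarrow>
    compact_space (mtopology_of M) \<and> weakly_connected (mtopology_of M) (\<iota> ` points G)"
proof -
  interpret metric_graph G by fact
  interpret graph_completion G \<iota> M by unfold_locales fact
  show ?thesis
  proof (intro iffI conjI)
    assume hom: "mtopology_of M homeomorphic_space end_compactification G"
    show "compact_space (mtopology_of M)"
      using homeomorphic_compact_space[OF hom] compact_end_compactification by simp
    show "weakly_connected (mtopology_of M) (\<iota> ` points G)"
      by (rule weakly_connected_if_homeomorphic[OF hom])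
  qed (use homeomorphic_if_weakly_connected in simp)
qed

end
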